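(* Let $n,m,m'$ be non-negative integers with $n\ge 1$, let $\alpha=(\alpha_1,\dots,\alpha_m)$ and $\beta=(\beta_1,\dots,\beta_{m'})$ be vectors of non-negative integers, and let $\lambda$ be a partition of $n$. The multiplicity of the irreducible $S_n$-module indexed by $\lambda$ in the homogeneous component of $\mathbb{C}[X_{n\times m};\Theta_{n\times m'}]$ of degree $\alpha$ in the commuting variables and degree $\beta$ in the Grassmannian variables is equal to the number of multiset tableaux of shape $\lambda$ and content $\{\!\{1^{\alpha_1},2^{\alpha_2},\dots,m^{\alpha_m},\bar1^{\beta_1},\dots,\overline{m'}^{\beta_{m'}}\}\!\}$.
   Context: $\mathbb{C}[X_{n\times m};\Theta_{n\times m'}]$ is the associative $\mathbb{C}$-algebra generated by variables $x_{rk}$ ($1\le r\le n$, $1\le k\le m$) and $\theta_{ri}$ ($1\le r\le n$, $1\le i\le m'$) subject to: the $x_{rk}$ commute with each other and with all $\theta_{si}$; $\theta_{ri}\theta_{sj}=-\theta_{sj}\theta_{ri}$ for $(r,i)\neq(s,j)$; and $\theta_{ri}^2=0$. The symmetric group $S_n$ acts by algebra automorphisms via $\sigma(x_{rk})=x_{\sigma(r)k}$, $\sigma(\theta_{ri})=\theta_{\sigma(r)i}$. A monomial has degree $\alpha=(\alpha_1,\dots,\alpha_m)$ in the commuting variables and $\beta=(\beta_1,\dots,\beta_{m'})$ in the Grassmannian variables if its total degree in $x_{1k},\dots,x_{nk}$ is $\alpha_k$ for each $k$ and its total degree in $\theta_{1i},\dots,\theta_{ni}$ is $\beta_i$ for each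 $i$; the span of such monomials is an $S_n$-submodule. Irreducible $S_n$-modules are indexed by partitions of $n$ in the standard way. Alphabet: $[m]\cup[\overline{m'}]=\{1,\dots,m\}\cup\{\bar1,\dots,\overline{m'}\}$, totally ordered by $1<2<\dots<m<\bar1<\dots<\overline{m'}$. Entries $\bar j$ are called barred. Finite multisets over this alphabet are totally ordered as follows: write each multiset as its weakly increasing word and compare words lexicographically (a proper prefix being smaller); in particular the empty multiset is the smallest. For a partition $\lambda=(\lambda_1\ge\lambda_2\ge\dots)$, its cells are the pairs $(i,j)$ with $1\le i\le\ell(\lambda)$, $1\le j\le\lambda_i$ ($i$ = row, $j$ = column). A multiset tableau of shape $\lambda$ is a map $T$ from the cells of $\lambda$ to finite (possibly empty) multisets over $[m]\cup[\overline{m'}]$ such that: (1) no barred entry appears more than once in any $T(c)$; (2) $T(i,j)\le T(i+1,j)$ and $T(i,j)\le T(i,j+1)$ whenever both cells lie in $\lambda$; (3) if a multiset $S$ contains an even number (possibly zero) of barred entries, then any two distinct cells labelled $S$ lie in different columns; (4) if $S$ contains an odd number of barred entries, then any two distinct cells labelled $S$ lie in different rows. The content of $T$ is the multiset union of all $T(c)$. $\{\!\{1^{a_1},\dots\}\!\}$ denotes the multiset containing $1$ with multiplicity $a_1$, etc. *)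

theory Defs
  imports Complex_Main "HOL-Library.Multiset" "HOL-Library.Function_Algebras"
    "HOL-Library.Product_Lexorder" "HOL-Combinatorics.Permutations"
begin

(* All indices are 0-based: rows r < n, commuting column k < m = length alpha,
   Grassmannian column i < m' = length beta, Young cells (i,j) with i < length la, j < la!i. *)

definition is_partition :: "nat \<Rightarrow> nat list \<Rightarrow> bool" where
  "is_partition n la \<longleftrightarrow> sorted (rev la) \<and> (\<forall>x\<in>set la. 0 < x) \<and> sum_list la = n"

definition young_cells :: "nat list \<Rightarrow> (nat \<times> nat) set" where
  "young_cells la = {(i, j). i < length la \<and> j < la ! i}"

text \<open>A monomial  prod x_rk^(a r k) * theta_S  (theta_S = product of the theta_ri, (r,i) in S,
  taken in increasing lexicographic order of (r,i)) is encoded as the pair (a, S).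
  The component of degree alpha / beta has these monomials as a basis; a vector is encoded
  by its coefficient function.\<close>

type_synonym monomial = "(nat \<Rightarrow> nat \<Rightarrow> nat) \<times> (nat \<times> nat) set"

definition deg_monomials :: "nat \<Rightarrow> nat list \<Rightarrow> nat list \<Rightarrow> monomial set" where
  "deg_monomials n \<alpha> \<beta> = {(a, S).
     (\<forall>r k. (n \<le> r \<or> length \<alpha> \<le> k) \<longrightarrow> a r k = 0) \<and>
     (\<forall>k < length \<alpha>. (\<Sum>r<n. a r k) = \<alpha> ! k) \<and>
     S \<subseteq> {0..<n} \<times> {0..<length \<beta>} \<and>
     (\<forall>i < length \<beta>. card {r. (r, i) \<in> S} = \<beta> ! i)}"

definition component :: "nat \<Rightarrow> nat list \<Rightarrow> nat list \<Rightarrow> (monomial \<Rightarrow> complex) set" where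
  "component n \<alpha> \<beta> = {f. \<forall>\<mu>. \<mu> \<notin> deg_monomials n \<alpha> \<beta> \<longrightarrow> f \<mu> = 0}"

text \<open>sigma(x_rk) = x_(sigma r)k, sigma(theta_ri) = theta_(sigma r)i, on monomials; the sign
  comes from reordering the anticommuting theta's back into increasing order.\<close>

definition mon_act :: "(nat \<Rightarrow> nat) \<Rightarrow> monomial \<Rightarrow> monomial" where
  "mon_act \<sigma> \<mu> = ((\<lambda>r k. fst \<mu> (inv \<sigma> r) k), (\<lambda>(r, i). (\<sigma> r, i)) ` snd \<mu>)"

definition mon_sign :: "(nat \<Rightarrow> nat) \<Rightarrow> monomial \<Rightarrow> complex" where
  "mon_sign \<sigma> \<mu> = (-1) ^ card {(p, q). p \<in> snd \<mu> \<and> q \<in> snd \<mu> \<and> p < q \<and>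
                         (\<sigma> (fst q), snd q) < (\<sigma> (fst p), snd p)}"

definition comp_rep :: "nat \<Rightarrow> nat list \<Rightarrow> nat list \<Rightarrow> (nat \<Rightarrow> nat)
    \<Rightarrow> (monomial \<Rightarrow> complex) \<Rightarrow> (monomial \<Rightarrow> complex)" where
  "comp_rep n \<alpha> \<beta> \<sigma> f = (\<lambda>\<nu>. \<Sum>\<mu>\<in>deg_monomials n \<alpha> \<beta>.
      if mon_act \<sigma> \<mu> = \<nu> then mon_sign \<sigma> \<mu> * f \<mu> else 0)"

text \<open>A tabloid is encoded as the function sending an entry k < n to the row containing it.\<close>

definition tableaux :: "nat list \<Rightarrow> nat \<Rightarrow> (nat \<times> nat \<Rightarrow> nat) set" where
  "tableaux la n = {T. bij_betw T (young_cells la) {0..<n} \<and> (\<forall>c. c \<notin> young_cells la \<longrightarrow> T c = 0)}"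

definition tabloid_of :: "nat list \<Rightarrow> nat \<Rightarrow> (nat \<times> nat \<Rightarrow> nat) \<Rightarrow> (nat \<Rightarrow> nat)" where
  "tabloid_of la n T = (\<lambda>k. if k < n then fst (inv_into (young_cells la) T k) else 0)"

definition col_stab :: "nat list \<Rightarrow> nat \<Rightarrow> (nat \<times> nat \<Rightarrow> nat) \<Rightarrow> (nat \<Rightarrow> nat) set" where
  "col_stab la n T = {\<pi>. \<pi> permutes {0..<n} \<and>
      (\<forall>c\<in>young_cells la. \<exists>c'\<in>young_cells la. snd c' = snd c \<and> T c' = \<pi> (T c))}"

definition polytabloid :: "nat list \<Rightarrow> nat \<Rightarrow> (nat \<times> nat \<Rightarrow> nat) \<Rightarrow> ((nat \<Rightarrow> nat) \<Rightarrow> complex)" where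
  "polytabloid la n T = (\<lambda>t. \<Sum>\<pi>\<in>col_stab la n T.
      if tabloid_of la n (\<pi> \<circ> T) = t then of_int (sign \<pi>) else 0)"

definition specht :: "nat list \<Rightarrow> nat \<Rightarrow> ((nat \<Rightarrow> nat) \<Rightarrow> complex) set" where
  "specht la n = {(\<lambda>t. \<Sum>T\<in>tableaux la n. c T * polytabloid la n T t) | c. True}"

text \<open>Permutation action on (linear combinations of) tabloids: (sigma t)(j) = t(inv sigma j).\<close>
definition tab_rep :: "(nat \<Rightarrow> nat) \<Rightarrow> ((nat \<Rightarrow> nat) \<Rightarrow> complex) \<Rightarrow> ((nat \<Rightarrow> nat) \<Rightarrow> complex)" where
  "tab_rep \<sigma> f = (\<lambda>t. f (t \<circ> \<sigma>))"

definition hom_specht ::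
  "nat list \<Rightarrow> nat \<Rightarrow> ('v \<Rightarrow> complex) set \<Rightarrow> ((nat \<Rightarrow> nat) \<Rightarrow> ('v \<Rightarrow> complex) \<Rightarrow> ('v \<Rightarrow> complex))
   \<Rightarrow> (((nat \<Rightarrow> nat) \<Rightarrow> complex) \<Rightarrow> ('v \<Rightarrow> complex)) set" where
  "hom_specht la n V \<rho> = {\<phi>.
     (\<forall>f. f \<notin> specht la n \<longrightarrow> \<phi> f = 0) \<and>
     (\<forall>f\<in>specht la n. \<phi> f \<in> V) \<and>
     (\<forall>f\<in>specht la n. \<forall>g\<in>specht la n. \<phi> (\<lambda>t. f t + g t) = (\<lambda>v. \<phi> f v + \<phi> g v)) \<and>
     (\<forall>c. \<forall>f\<in>specht la n. \<phi> (\<lambda>t. c * f t) = (\<lambda>v. c * \<phi> f v)) \<and>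
     (\<forall>\<sigma>. \<sigma> permutes {0..<n} \<longrightarrow> (\<forall>f\<in>specht la n. \<phi> (tab_rep \<sigma> f) = \<rho> \<sigma> (\<phi> f)))}"

definition multiplicity ::
  "nat list \<Rightarrow> nat \<Rightarrow> ('v \<Rightarrow> complex) set \<Rightarrow> ((nat \<Rightarrow> nat) \<Rightarrow> ('v \<Rightarrow> complex) \<Rightarrow> ('v \<Rightarrow> complex)) \<Rightarrow> nat" where
  "multiplicity la n V \<rho> =
     vector_space.dim (\<lambda>(c::complex) \<phi>. (\<lambda>f v. c * \<phi> f v)) (hom_specht la n V \<rho>)"

text \<open>Letters: (False, k) is the unbarred letter k+1 (k < m), (True, i) is the barred letter
  (i+1)-bar (i < m'). The lexicographic order on bool \<times> nat is exactly
  1 < ... < m < 1bar < ... < m'bar.\<close>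
type_synonym letter = "bool \<times> nat"

definition ms_less :: "letter multiset \<Rightarrow> letter multiset \<Rightarrow> bool" where
  "ms_less S T \<longleftrightarrow>
     (sorted_list_of_multiset S, sorted_list_of_multiset T) \<in> lexord {(x, y). x < y}"

definition ms_le :: "letter multiset \<Rightarrow> letter multiset \<Rightarrow> bool" where
  "ms_le S T \<longleftrightarrow> S = T \<or> ms_less S T"

definition num_barred :: "letter multiset \<Rightarrow> nat" where
  "num_barred S = size (filter_mset fst S)"

definition is_multiset_tableau :: "nat list \<Rightarrow> (nat \<times> nat \<Rightarrow> letter multiset) \<Rightarrow> bool" where
  "is_multiset_tableau la T \<longleftrightarrow>
     (\<forall>c\<in>young_cells la. \<forall>i. count (T c) (True, i) \<le> 1) \<and>
     (\<forall>i j. (i, j) \<in> young_cells la \<and> (i + 1, j) \<in> young_cells la \<longrightarrow> ms_le (T (i, j)) (T (i + 1, j))) \<and>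
     (\<forall>i j. (i, j) \<in> young_cells la \<and> (i, j + 1) \<in> young_cells la \<longrightarrow> ms_le (T (i, j)) (T (i, j + 1))) \<and>
     (\<forall>c\<in>young_cells la. \<forall>d\<in>young_cells la. c \<noteq> d \<and> T c = T d \<and> even (num_barred (T c))
         \<longrightarrow> snd c \<noteq> snd d) \<and>
     (\<forall>c\<in>young_cells la. \<forall>d\<in>young_cells la. c \<noteq> d \<and> T c = T d \<and> odd (num_barred (T c))
         \<longrightarrow> fst c \<noteq> fst d)"

definition tableau_content :: "nat list \<Rightarrow> (nat \<times> nat \<Rightarrow> letter multiset) \<Rightarrow> letter multiset" where
  "tableau_content la T = (\<Sum>c\<in>young_cells la. T c)"

definition target_content :: "nat list \<Rightarrow> nat list \<Rightarrow> letter multiset" where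
  "target_content \<alpha> \<beta> =
     (\<Sum>k<length \<alpha>. replicate_mset (\<alpha> ! k) (False, k)) +
     (\<Sum>i<length \<beta>. replicate_mset (\<beta> ! i) (True, i))"

text \<open>Tableaux are taken extensional (empty multiset outside the diagram) so they can be counted.\<close>
definition multiset_tableaux :: "nat list \<Rightarrow> letter multiset \<Rightarrow> (nat \<times> nat \<Rightarrow> letter multiset) set" where
  "multiset_tableaux la C = {T. is_multiset_tableau la T \<and> (\<forall>c. c \<notin> young_cells la \<longrightarrow> T c = {#})
      \<and> tableau_content la T = C}"

end

theory Submission
  imports Defs
begin

text \<open>The argument is James' construction of semistandard homomorphisms, carried out with signs; no
  semisimplicity or character theory is needed. Fix a tableau \<open>t0\<close> and let \<open>e\<close> be its polytabloid.
  A monomial is a filling of the diagram: the cell containing \<open>r\<close> in \<open>t0\<close> is labelled with the multiset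
  of letters of row \<open>r\<close>. A homomorphism from the Specht module is determined by \<open>v = \<phi> e\<close>, which is
  alternating under the column stabiliser and killed by the Garnir elements. These relations
  force \<open>v = 0\<close> as soon as the coefficients of \<open>v\<close> at all multiset tableaux vanish, so there are at most as
  many independent homomorphisms as multiset tableaux. Conversely, symmetrising a multiset tableau
  over the rows of \<open>t0\<close> yields a homomorphism, and the matrix of the coefficients of its value
  at \<open>e\<close> is triangular with respect to the statistic \<open>\<Phi>\<close> (sum of column index times rank of the label)
  with nonzero diagonal.\<close>

section \<open>Rearrangements and inversion signs\<close>


text \<open>Parity decides the conditions on repeated labels. By \<open>mon_sign_eq\<close> the sign
  of a row permutation counts only inversions among rows with an odd number of theta's, so swapping
  two equal labels acts by \<open>+1\<close> if they are even and by \<open>-1\<close> if they are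
  odd. Alternation under the column stabiliser thus forbids equal even labels in a column, and
  symmetrising over rows would cancel equal odd labels in a row: these are conditions (3) and (4).
  The obstacle is that \<open>\<Phi>\<close> is constant along column permutations and cannot single
  out a column-sorted monomial; a second statistic \<open>\<Psi>\<close>, weighted by row indices,
  breaks these ties. Both bounds rest on one rearrangement inequality, whose equality case tells
  which permutations leave the labelling unchanged. Characteristic 0 enters because Garnir sums run
  over full symmetric groups and diagonal coefficients count pairs: the resulting positive integers
  must be nonzero scalars.\<close>

text \<open>Induction that moves the largest value of a fibre of \<open>g\<close> to the largest
  weight. In the equality case \<open>f \<circ> \<rho>\<close> and \<open>f\<close> agree up to a
  permutation preserving \<open>g\<close> and \<open>h\<close>; when \<open>g\<close> and
  \<open>h\<close> are the row and the column of a cell, that permutation is the identity.\<close>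

lemma rearrangement:
  fixes f h :: "'a \<Rightarrow> nat" and g :: "'a \<Rightarrow> 'b"
  assumes "finite P" "\<rho> permutes P" "\<And>r. r \<in> P \<Longrightarrow> g (\<rho> r) = g r"
    and "\<And>r s. r \<in> P \<Longrightarrow> s \<in> P \<Longrightarrow> g r = g s \<Longrightarrow> h r < h s \<Longrightarrow> f r \<le> f s"
  shows "(\<Sum>r\<in>P. h r * f (\<rho> r)) \<le> (\<Sum>r\<in>P. h r * f r) \<and>
    ((\<Sum>r\<in>P. h r * f (\<rho> r)) = (\<Sum>r\<in>P. h r * f r) \<longrightarrow>
      (\<exists>\<pi>. \<pi> permutes P \<and> (\<forall>r\<in>P. g (\<pi> r) = g r \<and> h (\<pi> r) = h r \<and> f (\<rho> (\<pi> r)) = f r)))"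
  using assms
proof (induction "card P" arbitrary: P \<rho>)
  case 0
  then have "P = {}" by simp
  then show ?case by (auto intro!: exI[of _ id] simp: permutes_id)
next
  case (Suc n P \<rho>)
  note fin = \<open>finite P\<close> and perm = \<open>\<rho> permutes P\<close> and gr = Suc.prems(3) and mono = Suc.prems(4)
  from Suc have ne: "P \<noteq> {}" by auto
  define M where "M = {r \<in> P. h r = Max (h ` P)}"
  have "Max (h ` P) \<in> h ` P" using fin ne by simp
  then have "M \<noteq> {}" by (auto simp: M_def)
  have "finite M" using fin by (simp add: M_def)
  \<comment> \<open>Largest weight first, then largest value: together with the monotonicity of
    \<open>f\<close> against \<open>h\<close> this makes \<open>f s\<close> maximal in its whole
    fibre.\<close>
  obtain s where s: "s \<in> M" "\<And>r. r \<in> M \<Longrightarrow> f r \<le> f s"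
  proof -
    have "Max (f ` M) \<in> f ` M" using \<open>finite M\<close> \<open>M \<noteq> {}\<close> by simp
    then obtain s where "s \<in> M" "f s = Max (f ` M)" by auto
    then show ?thesis using that[of s] \<open>finite M\<close> by simp
  qed
  have sP: "s \<in> P" and hs: "\<And>r. r \<in> P \<Longrightarrow> h r \<le> h s"
    using s(1) fin by (auto simp: M_def)
  have fs: "f r \<le> f s" if "r \<in> P" "g r = g s" for r
  proof (cases "h r = h s")
    case True
    then show ?thesis using s that by (auto simp: M_def)
  next
    case False
    then show ?thesis using mono[OF that(1) sP that(2)] hs[OF that(1)] by simp
  qed
  define a where "a = inv \<rho> s"
  define b where "b = \<rho> s"
  have ra: "\<rho> a = s" unfolding a_def using permutes_inverses[OF perm] by simp
  have aP: "a \<in> P" using permutes_in_image[OF perm, of a] ra sP by simp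
  have bP: "b \<in> P" unfolding b_def using permutes_in_image[OF perm] sP by simp
  have ga: "g a = g s" using gr[OF aP] ra by simp
  have gb: "g b = g s" using gr[OF sP] by (simp add: b_def)
  define t where "t = transpose a s"
  have t: "t permutes P" unfolding t_def using aP sP by (rule permutes_swap_id)
  \<comment> \<open>Swapping \<open>s\<close> with its preimage \<open>a\<close> turns
    \<open>s\<close> into a fixed point, so the induction hypothesis applies to
    \<open>P - {s}\<close>; the swap stays in one fibre of \<open>g\<close>.\<close>
  define \<rho>' where "\<rho>' = \<rho> \<circ> t"
  have r's: "\<rho>' s = s" by (simp add: \<rho>'_def t_def ra)
  have p'P: "\<rho>' permutes P" unfolding \<rho>'_def by (rule permutes_compose[OF t perm])
  have p': "\<rho>' permutes (P - {s})"
    by (rule permutes_superset[OF p'P]) (use r's in auto)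
  have g': "g (\<rho>' r) = g r" if "r \<in> P" for r
    using that gr ga aP sP unfolding \<rho>'_def t_def by (auto simp: transpose_def)
  have "n = card (P - {s})" using Suc.hyps(2) sP fin by simp
  then have IH: "(\<Sum>r\<in>P - {s}. h r * f (\<rho>' r)) \<le> (\<Sum>r\<in>P - {s}. h r * f r) \<and>
    ((\<Sum>r\<in>P - {s}. h r * f (\<rho>' r)) = (\<Sum>r\<in>P - {s}. h r * f r) \<longrightarrow>
      (\<exists>\<pi>. \<pi> permutes (P - {s}) \<and> (\<forall>r\<in>P - {s}. g (\<pi> r) = g r \<and> h (\<pi> r) = h r \<and> f (\<rho>' (\<pi> r)) = f r)))"
    by (rule Suc.hyps(1)) (use fin p' g' mono in auto)
  have sum': "(\<Sum>r\<in>P. h r * f (\<rho>' r)) = h s * f s + (\<Sum>r\<in>P - {s}. h r * f (\<rho>' r))"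
    "(\<Sum>r\<in>P. h r * f r) = h s * f s + (\<Sum>r\<in>P - {s}. h r * f r)"
    using sum.remove[OF fin sP, of "\<lambda>r. h r * f (\<rho>' r)"] sum.remove[OF fin sP, of "\<lambda>r. h r * f r"]
    by (simp_all only: r's)
  show ?case
  proof (cases "a = s")
    case True
    then have rr: "\<rho>' = \<rho>" by (simp add: \<rho>'_def t_def)
    have le: "(\<Sum>r\<in>P - {s}. h r * f (\<rho>' r)) \<le> (\<Sum>r\<in>P - {s}. h r * f r)" using IH by auto
    have eqc: "\<exists>\<pi>. \<pi> permutes P \<and> (\<forall>r\<in>P. g (\<pi> r) = g r \<and> h (\<pi> r) = h r \<and> f (\<rho> (\<pi> r)) = f r)"
      if "(\<Sum>r\<in>P - {s}. h r * f (\<rho>' r)) = (\<Sum>r\<in>P - {s}. h r * f r)"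
    proof -
      from IH that obtain \<pi> where \<pi>: "\<pi> permutes P - {s}"
        "\<And>r. r\<in>P \<Longrightarrow> r \<noteq> s \<Longrightarrow> g (\<pi> r) = g r \<and> h (\<pi> r) = h r \<and> f (\<rho>' (\<pi> r)) = f r"
        by auto
      have "\<pi> s = s" using \<pi>(1) by (auto intro: permutes_not_in)
      then show ?thesis
        using \<pi> rr r's by (intro exI[of _ \<pi>]) (metis Diff_subset permutes_subset)
    qed
    show ?thesis
    proof (intro conjI impI)
      show "(\<Sum>r\<in>P. h r * f (\<rho> r)) \<le> (\<Sum>r\<in>P. h r * f r)" using sum' le unfolding rr by linarith
      assume "(\<Sum>r\<in>P. h r * f (\<rho> r)) = (\<Sum>r\<in>P. h r * f r)"
      then show "\<exists>\<pi>. \<pi> permutes P \<and> (\<forall>r\<in>P. g (\<pi> r) = g r \<and> h (\<pi> r) = h r \<and> f (\<rho> (\<pi> r)) = f r)"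
        by (intro eqc) (use sum' in \<open>unfold rr, linarith\<close>)
    qed
  next
    case False
    define Q where "Q = P - {s} - {a}"
    have split: "sum F P = F s + F a + sum F Q" for F :: "'a \<Rightarrow> nat"
      unfolding Q_def using sum.remove[OF fin sP, of F] sum.remove[of "P - {s}" a F] fin aP False by simp
    have Qeq: "(\<Sum>r\<in>Q. h r * f (\<rho>' r)) = (\<Sum>r\<in>Q. h r * f (\<rho> r))"
      by (rule sum.cong) (auto simp: Q_def \<rho>'_def t_def)
    have r'a: "\<rho>' a = b" by (simp add: \<rho>'_def t_def b_def)
    have e1: "(\<Sum>r\<in>P. h r * f (\<rho> r)) = h s * f b + h a * f s + (\<Sum>r\<in>Q. h r * f (\<rho> r))"
      by (subst split) (simp add: b_def ra)
    have e2: "(\<Sum>r\<in>P. h r * f (\<rho>' r)) = h s * f s + h a * f b + (\<Sum>r\<in>Q. h r * f (\<rho> r))"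
      by (subst split) (simp add: r's r'a Qeq)
    \<comment> \<open>The swap raises the sum by \<open>d * e\<close>. Equality leaves two cases:
      \<open>e = 0\<close>, where the swap does not change the values, or \<open>d = 0\<close>,
      where it preserves \<open>h\<close> and is absorbed into \<open>\<pi>\<close>.\<close>
    obtain d where d: "h s = h a + d" using hs[OF aP] le_Suc_ex by blast
    obtain e where e: "f s = f b + e" using fs[OF bP gb] le_Suc_ex by blast
    have e3: "(\<Sum>r\<in>P. h r * f (\<rho>' r)) = (\<Sum>r\<in>P. h r * f (\<rho> r)) + d * e"
      unfolding e1 e2 d e by (simp add: algebra_simps)
    have le: "(\<Sum>r\<in>P - {s}. h r * f (\<rho>' r)) \<le> (\<Sum>r\<in>P - {s}. h r * f r)" using IH by auto
    have eqc: "\<exists>\<pi>. \<pi> permutes P \<and> (\<forall>r\<in>P. g (\<pi> r) = g r \<and> h (\<pi> r) = h r \<and> f (\<rho> (\<pi> r)) = f r)"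
      if "(\<Sum>r\<in>P - {s}. h r * f (\<rho>' r)) = (\<Sum>r\<in>P - {s}. h r * f r)" and de: "d * e = 0"
    proof -
      from IH that obtain \<pi> where \<pi>: "\<pi> permutes P - {s}"
        "\<And>r. r\<in>P \<Longrightarrow> r \<noteq> s \<Longrightarrow> g (\<pi> r) = g r \<and> h (\<pi> r) = h r \<and> f (\<rho>' (\<pi> r)) = f r"
        by auto
      have \<pi>P: "\<pi> permutes P" using \<pi>(1) by (metis Diff_subset permutes_subset)
      have \<pi>s: "\<pi> s = s" using \<pi>(1) by (auto intro: permutes_not_in)
      have \<pi>': "g (\<pi> r) = g r \<and> h (\<pi> r) = h r \<and> f (\<rho>' (\<pi> r)) = f r" if "r \<in> P" for r
        using \<pi>(2)[OF that] \<pi>s r's by (cases "r = s") auto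
      show ?thesis
      proof (cases "e = 0")
        case True
        have "f (\<rho>' r) = f (\<rho> r)" for r
          using True e ra by (auto simp: \<rho>'_def t_def transpose_def b_def)
        then show ?thesis using \<pi>P \<pi>' by (intro exI[of _ \<pi>]) auto
      next
        case False
        then have "h s = h a" using de d by simp
        then have gt: "g (t r) = g r" "h (t r) = h r" for r
          using ga by (auto simp: t_def transpose_def)
        show ?thesis
          using \<pi>' gt permutes_compose[OF \<pi>P t] by (intro exI[of _ "t \<circ> \<pi>"]) (auto simp: \<rho>'_def)
      qed
    qed
    show ?thesis
    proof (intro conjI impI)
      show "(\<Sum>r\<in>P. h r * f (\<rho> r)) \<le> (\<Sum>r\<in>P. h r * f r)" using sum' le e3 by linarith
      assume "(\<Sum>r\<in>P. h r * f (\<rho> r)) = (\<Sum>r\<in>P. h r * f r)"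
      then have "(\<Sum>r\<in>P - {s}. h r * f (\<rho>' r)) = (\<Sum>r\<in>P - {s}. h r * f r)" "d * e = 0"
        using sum' le e3 by linarith+
      then show "\<exists>\<pi>. \<pi> permutes P \<and> (\<forall>r\<in>P. g (\<pi> r) = g r \<and> h (\<pi> r) = h r \<and> f (\<rho> (\<pi> r)) = f r)"
        by (rule eqc)
    qed
  qed
qed

text \<open>\<open>\<sigma>\<close> need not map \<open>S\<close> to itself: for injective
  \<open>\<sigma>\<close> this is the sign of sorting the images of the elements of \<open>S\<close>
  listed increasingly. It is used for theta indices and for rows, hence the general linear
  order.\<close>

definition inv_sign :: "('a::linorder \<Rightarrow> 'a) \<Rightarrow> 'a set \<Rightarrow> complex" where
  "inv_sign \<sigma> S = (-1) ^ card {(p, q). p \<in> S \<and> q \<in> S \<and> p < q \<and> \<sigma> q < \<sigma> p}"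

lemma inv_sign_prod:
  assumes "finite S"
  shows "inv_sign \<sigma> S = (\<Prod>(p, q)\<in>{(p, q). p \<in> S \<and> q \<in> S \<and> p < q}. if \<sigma> q < \<sigma> p then -1 else 1)"
proof -
  have fin: "finite {(p, q). p \<in> S \<and> q \<in> S \<and> p < q}"
    by (rule finite_subset[of _ "S \<times> S"]) (use assms in auto)
  have "{x \<in> {(p, q). p \<in> S \<and> q \<in> S \<and> p < q}. \<sigma> (snd x) < \<sigma> (fst x)} =
    {(p, q). p \<in> S \<and> q \<in> S \<and> p < q \<and> \<sigma> q < \<sigma> p}" by auto
  then have "inv_sign \<sigma> S = (\<Prod>x\<in>{x \<in> {(p, q). p \<in> S \<and> q \<in> S \<and> p < q}. \<sigma> (snd x) < \<sigma> (fst x)}. - 1)"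
    by (simp add: inv_sign_def)
  also have "\<dots> = (\<Prod>x\<in>{(p, q). p \<in> S \<and> q \<in> S \<and> p < q}. if \<sigma> (snd x) < \<sigma> (fst x) then -1 else 1)"
    by (rule prod.inter_filter[OF fin])
  finally show ?thesis by (simp add: case_prod_beta)
qed

text \<open>A pair is inverted by the composite iff exactly one of the two steps inverts it; pairs
  of \<open>S\<close> are matched with pairs of its image by sorting the image pair
  (\<open>m\<close>). This cocycle identity makes the signed action multiplicative.\<close>

lemma inv_sign_comp:
  assumes fin: "finite S" and inj: "inj_on \<tau> S" "inj_on \<sigma> (\<tau> ` S)"
  shows "inv_sign (\<sigma> \<circ> \<tau>) S = inv_sign \<sigma> (\<tau> ` S) * inv_sign \<tau> S"
proof -
  let ?P = "\<lambda>S. {(p, q). p \<in> S \<and> q \<in> S \<and> p < q}"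
  let ?s = "\<lambda>\<sigma>. \<lambda>(p, q). (if \<sigma> q < \<sigma> p then -1 else 1) :: complex"
  define m where "m = (\<lambda>(p, q). (min (\<tau> p) (\<tau> q), max (\<tau> p) (\<tau> q)))"
  define m' where "m' = (\<lambda>(p, q). (min (inv_into S \<tau> p) (inv_into S \<tau> q), max (inv_into S \<tau> p) (inv_into S \<tau> q)))"
  have ne: "\<tau> p \<noteq> \<tau> q" if "p \<in> S" "q \<in> S" "p < q" for p q
    using that inj(1) by (auto simp: inj_on_def)
  have ne': "\<sigma> (\<tau> p) \<noteq> \<sigma> (\<tau> q)" if "p \<in> S" "q \<in> S" "p < q" for p q
    using that ne[OF that] inj(2) by (auto simp: inj_on_def)
  have [simp]: "inv_into S \<tau> (\<tau> x) = x" if "x \<in> S" for x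
    using inj(1) that by simp
  have "(\<Prod>x\<in>?P (\<tau> ` S). ?s \<sigma> x) = (\<Prod>x\<in>?P S. ?s \<sigma> (m x))"
  proof (rule prod.reindex_bij_witness[of _ m m'])
    fix x assume x: "x \<in> ?P (\<tau> ` S)"
    then obtain p q where pq: "x = (\<tau> p, \<tau> q)" "p \<in> S" "q \<in> S" "\<tau> p < \<tau> q" by auto
    then have "p \<noteq> q" by auto
    then show "m (m' x) = x" "m' x \<in> ?P S" "?s \<sigma> (m (m' x)) = ?s \<sigma> x"
      using pq by (auto simp: m_def m'_def min_def max_def split: if_splits)
  next
    fix x assume "x \<in> ?P S"
    then obtain p q where pq: "x = (p, q)" "p \<in> S" "q \<in> S" "p < q" by auto
    then show "m' (m x) = x" "m x \<in> ?P (\<tau> ` S)"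
      using ne[OF pq(2-4)] by (auto simp: m_def m'_def min_def max_def split: if_splits)
  qed
  moreover have "?s (\<sigma> \<circ> \<tau>) x = ?s \<sigma> (m x) * ?s \<tau> x" if "x \<in> ?P S" for x
    using that ne ne' by (fastforce simp: m_def min_def max_def)
  then have "(\<Prod>x\<in>?P S. ?s (\<sigma> \<circ> \<tau>) x) = (\<Prod>x\<in>?P S. ?s \<sigma> (m x)) * (\<Prod>x\<in>?P S. ?s \<tau> x)"
    by (simp only: prod.distrib[symmetric] cong: prod.cong)
  ultimately show ?thesis
    using fin by (simp add: inv_sign_prod)
qed

lemma inv_sign_fixed:
  assumes "\<And>x. x \<in> S \<Longrightarrow> \<sigma> x = x"
  shows "inv_sign \<sigma> S = 1"
proof -
  have "{(p, q). p \<in> S \<and> q \<in> S \<and> p < q \<and> \<sigma> q < \<sigma> p} = {}" using assms by auto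
  then show ?thesis by (simp only: inv_sign_def card.empty power_0)
qed

text \<open>The inversions are \<open>(a, b)\<close> and, for each \<open>x\<close> in
  \<open>S\<close> strictly between, \<open>(a, x)\<close> and \<open>(x, b)\<close>: an odd
  number.\<close>

lemma inv_sign_transpose:
  assumes fin: "finite S" and ab: "a \<in> S" "b \<in> S" "a < b"
  shows "inv_sign (transpose a b) S = -1"
proof -
  let ?I = "{x \<in> S. a < x \<and> x < b}"
  have "{(p, q). p \<in> S \<and> q \<in> S \<and> p < q \<and> transpose a b q < transpose a b p} =
      insert (a, b) (Pair a ` ?I \<union> (\<lambda>x. (x, b)) ` ?I)"
    using ab by (auto simp: transpose_def image_iff split: if_splits)
  moreover have "card (Pair a ` ?I \<union> (\<lambda>x. (x, b)) ` ?I) = card (Pair a ` ?I) + card ((\<lambda>x. (x, b)) ` ?I)"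
    by (rule card_Un_disjoint) (use fin in auto)
  moreover have "card (Pair a ` ?I) = card ?I" "card ((\<lambda>x. (x, b)) ` ?I) = card ?I"
    by (auto intro!: card_image inj_onI)
  ultimately have "card {(p, q). p \<in> S \<and> q \<in> S \<and> p < q \<and> transpose a b q < transpose a b p} = Suc (2 * card ?I)"
    using fin by (subst \<open>_ = insert _ _\<close>, subst card_insert_disjoint) auto
  then show ?thesis by (simp add: inv_sign_def)
qed

text \<open>Induction on transpositions with the cocycle identity. \<open>S\<close> may exceed the
  support, since fixed points do not disturb the parity.\<close>

lemma inv_sign_permutes:
  assumes "\<sigma> permutes P" "P \<subseteq> S" "finite S"
  shows "inv_sign \<sigma> S = of_int (sign \<sigma>)"
proof -
  have "finite P" using assms finite_subset by blast
  from \<open>\<sigma> permutes P\<close> this show ?thesis using assms(2,3)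
  proof (induction \<sigma> rule: permutes_induct)
    case id
    then show ?case by (simp add: inv_sign_fixed)
  next
    case (swap a b p)
    have pS: "p ` S = S" using swap by (metis permutes_image permutes_subset)
    have inj: "inj p" using swap permutes_inj by blast
    have abS: "a \<in> S" "b \<in> S" using swap by auto
    have tr: "inv_sign (transpose a b) S = -1"
    proof (cases "a < b")
      case True
      then show ?thesis using inv_sign_transpose[of S a b] swap abS by auto
    next
      case False
      then have "b < a" using swap by simp
      with \<open>finite S\<close> abS have "inv_sign (transpose b a) S = -1" by (intro inv_sign_transpose)
      then show ?thesis by (subst transpose_commute)
    qed
    have "inv_sign (transpose a b \<circ> p) S = inv_sign (transpose a b) (p ` S) * inv_sign p S"
      by (rule inv_sign_comp) (use swap inj in \<open>auto intro: inj_on_subset\<close>)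
    moreover have "permutation p" using \<open>p permutes P\<close> \<open>finite P\<close> by (auto simp: permutation_permutes)
    moreover have "sign (transpose a b \<circ> p) = - sign p"
      using swap.hyps \<open>permutation p\<close> by (simp add: sign_compose permutation_swap_id sign_swap_id)
    moreover have "inv_sign p S = of_int (sign p)" by (rule swap.IH) fact+
    ultimately show ?case by (simp only: pS tr) simp
  qed
qed

section \<open>The signed permutation action on monomials\<close>


lemma inv_comp_permutes:
  "\<sigma> permutes A \<Longrightarrow> \<tau> permutes A \<Longrightarrow> inv (\<sigma> \<circ> \<tau>) = inv \<tau> \<circ> inv \<sigma>"
  by (simp add: o_inv_distrib permutes_bij)

definition row_label :: "nat \<Rightarrow> monomial \<Rightarrow> nat \<Rightarrow> letter multiset" where
  "row_label m \<mu> r = (\<Sum>k<m. replicate_mset (fst \<mu> r k) (False, k)) +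
     image_mset (Pair True) (mset_set {i. (r, i) \<in> snd \<mu>})"

lemma count_sum_replicate:
  fixes m :: nat
  shows "count (\<Sum>k<m. replicate_mset (f k) (b, k)) (c, j) = (if c = b \<and> j < m then f j else 0)"
  by (induction m) (auto simp: less_Suc_eq)

lemma count_row_label:
  assumes "finite (snd \<mu>)"
  shows "count (row_label m \<mu> r) (False, k) = (if k < m then fst \<mu> r k else 0)"
    and "count (row_label m \<mu> r) (True, i) = (if (r, i) \<in> snd \<mu> then 1 else 0)"
proof -
  have "{i. (r, i) \<in> snd \<mu>} \<subseteq> snd ` snd \<mu>" by force
  then have fin: "finite {i. (r, i) \<in> snd \<mu>}" using assms finite_subset by blast
  have "count (image_mset (Pair True) (mset_set {i. (r, i) \<in> snd \<mu>})) (False, k) = 0"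
    by (auto simp: count_eq_zero_iff)
  then show "count (row_label m \<mu> r) (False, k) = (if k < m then fst \<mu> r k else 0)"
    by (simp add: row_label_def count_sum_replicate)
  have "count (image_mset (Pair True) M) (True, i) = count M i" for M :: "nat multiset"
    by (induction M) auto
  then show "count (row_label m \<mu> r) (True, i) = (if (r, i) \<in> snd \<mu> then 1 else 0)"
    using fin by (simp add: row_label_def count_sum_replicate)
qed

lemma num_barred_add [simp]: "num_barred (A + B) = num_barred A + num_barred B"
  by (simp add: num_barred_def)

lemma num_barred_row_label: "num_barred (row_label m \<mu> r) = card {i. (r, i) \<in> snd \<mu>}"
proof -
  have "num_barred (\<Sum>k<m. replicate_mset (fst \<mu> r k) (False, k)) = 0"
    by (induction m) (auto simp: num_barred_def filter_mset_eq_mempty_iff)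
  moreover have "num_barred (image_mset (Pair True) M) = size M" for M :: "nat multiset"
    by (induction M) (auto simp: num_barred_def)
  ultimately show ?thesis by (simp add: row_label_def)
qed

locale graded_piece =
  fixes n :: nat and \<alpha> \<beta> :: "nat list"
begin

abbreviation D :: "monomial set" where "D \<equiv> deg_monomials n \<alpha> \<beta>"

abbreviation lab :: "monomial \<Rightarrow> nat \<Rightarrow> letter multiset" where
  "lab \<equiv> row_label (length \<alpha>)"

definition odd_rows :: "monomial \<Rightarrow> nat set" where
  "odd_rows \<mu> = {r. r < n \<and> odd (num_barred (lab \<mu> r))}"

lemma finite_snd: "\<mu> \<in> D \<Longrightarrow> finite (snd \<mu>)"
  using finite_subset[of "snd \<mu>" "{0..<n} \<times> {0..<length \<beta>}"] by (auto simp: deg_monomials_def)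

lemma finite_D: "finite D"
proof -
  let ?F = "{f :: nat \<times> nat \<Rightarrow> nat. \<forall>x. (x \<in> {0..<n} \<times> {0..<length \<alpha>} \<longrightarrow> f x \<in> {..sum_list \<alpha>}) \<and>
    (x \<notin> {0..<n} \<times> {0..<length \<alpha>} \<longrightarrow> f x = 0)}"
  have "D \<subseteq> (\<lambda>(f, S). (\<lambda>r k. f (r, k), S)) ` (?F \<times> Pow ({0..<n} \<times> {0..<length \<beta>}))"
  proof
    fix \<mu> assume "\<mu> \<in> D"
    then obtain a S where \<mu>: "\<mu> = (a, S)" "(a, S) \<in> D" by (cases \<mu>) auto
    have "a r k \<le> sum_list \<alpha>" if "r < n" "k < length \<alpha>" for r k
    proof -
      have "a r k \<le> (\<Sum>r<n. a r k)" using that by (intro member_le_sum) auto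
      also have "\<dots> = \<alpha> ! k" using \<mu>(2) that by (simp add: deg_monomials_def)
      also have "\<dots> \<le> sum_list \<alpha>" using that by (simp add: elem_le_sum_list)
      finally show ?thesis .
    qed
    then have "(\<lambda>(r, k). a r k) \<in> ?F" using \<mu>(2) by (auto simp: deg_monomials_def)
    then have "(\<lambda>(f, S). (\<lambda>r k. f (r, k), S)) (\<lambda>(r, k). a r k, S) \<in> (\<lambda>(f, S). (\<lambda>r k. f (r, k), S)) ` (?F \<times> Pow ({0..<n} \<times> {0..<length \<beta>}))"
      by (intro imageI) (use \<mu>(2) in \<open>auto simp: deg_monomials_def\<close>)
    then show "\<mu> \<in> (\<lambda>(f, S). (\<lambda>r k. f (r, k), S)) ` (?F \<times> Pow ({0..<n} \<times> {0..<length \<beta>}))"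
      by (simp add: \<mu>)
  qed
  moreover have "finite ?F" by (rule finite_set_of_finite_funs) auto
  ultimately show ?thesis by (meson finite_Pow_iff finite_SigmaI finite_atLeastLessThan finite_imageI finite_subset)
qed

lemma snd_mon_act:
  assumes "bij \<sigma>"
  shows "(r, i) \<in> snd (mon_act \<sigma> \<mu>) \<longleftrightarrow> (inv \<sigma> r, i) \<in> snd \<mu>"
proof -
  have "(r, i) \<in> snd (mon_act \<sigma> \<mu>) \<longleftrightarrow> (\<exists>s. (s, i) \<in> snd \<mu> \<and> r = \<sigma> s)"
    by (force simp: mon_act_def image_iff)
  also have "\<dots> \<longleftrightarrow> (inv \<sigma> r, i) \<in> snd \<mu>" using assms by (metis bij_inv_eq_iff)
  finally show ?thesis .
qed

lemma lab_act: "bij \<sigma> \<Longrightarrow> lab (mon_act \<sigma> \<mu>) r = lab \<mu> (inv \<sigma> r)"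
  by (simp add: row_label_def snd_mon_act) (simp add: mon_act_def)

text \<open>The multiplicities of the letters recover exponents and theta's, and beyond the first
  \<open>n\<close> rows both are trivial on \<open>D\<close>.\<close>

lemma lab_inj:
  assumes "\<mu> \<in> D" "\<nu> \<in> D" and eq: "\<And>r. r < n \<Longrightarrow> lab \<mu> r = lab \<nu> r"
  shows "\<mu> = \<nu>"
proof -
  note c = count_row_label[OF finite_snd[OF assms(1)]] count_row_label[OF finite_snd[OF assms(2)]]
  have "fst \<mu> r k = fst \<nu> r k" for r k
  proof (cases "r < n \<and> k < length \<alpha>")
    case True
    then show ?thesis using c(1)[of "length \<alpha>" r k] c(3)[of "length \<alpha>" r k] eq by simp
  next
    case False
    then show ?thesis using assms(1,2) by (auto simp: deg_monomials_def)
  qed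
  moreover have "x \<in> snd \<mu> \<longleftrightarrow> x \<in> snd \<nu>" for x
  proof (cases x)
    case (Pair r i)
    show ?thesis
    proof (cases "r < n")
      case True
      have "(if (r, i) \<in> snd \<mu> then 1 else 0) = (if (r, i) \<in> snd \<nu> then 1 else (0::nat))"
        unfolding c(2,4)[of "length \<alpha>" r i, symmetric] eq[OF True] ..
      then show ?thesis unfolding Pair by (metis zero_neq_one)
    next
      case False
      then show ?thesis using assms(1,2) Pair by (auto simp: deg_monomials_def)
    qed
  qed
  ultimately show ?thesis by (intro prod_eqI) auto
qed

lemma mon_act_id: "mon_act id \<mu> = \<mu>"
  by (cases \<mu>) (auto simp: mon_act_def)

lemma mon_act_comp:
  assumes "bij \<sigma>" "bij \<tau>"
  shows "mon_act (\<sigma> \<circ> \<tau>) \<mu> = mon_act \<sigma> (mon_act \<tau> \<mu>)"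
proof -
  have "(\<lambda>(r, i). (\<sigma> (\<tau> r), i)) ` S = (\<lambda>(r, i). (\<sigma> r, i)) ` (\<lambda>(r, i). (\<tau> r, i)) ` S" for S :: "(nat \<times> nat) set"
    unfolding image_image by (rule image_cong) auto
  then show ?thesis using o_inv_distrib[OF assms] by (simp add: mon_act_def)
qed

lemma mon_act_inv:
  assumes "bij \<sigma>"
  shows "mon_act \<sigma> (mon_act (inv \<sigma>) \<mu>) = \<mu>" "mon_act (inv \<sigma>) (mon_act \<sigma> \<mu>) = \<mu>"
proof -
  have "\<sigma> \<circ> inv \<sigma> = id" "inv \<sigma> \<circ> \<sigma> = id" using assms by (simp_all add: bij_is_inj bij_is_surj surj_iff[symmetric])
  then show "mon_act \<sigma> (mon_act (inv \<sigma>) \<mu>) = \<mu>" "mon_act (inv \<sigma>) (mon_act \<sigma> \<mu>) = \<mu>"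
    using assms by (simp_all add: mon_act_comp[symmetric] bij_imp_bij_inv mon_act_id)
qed

lemma mon_act_in_D:
  assumes "\<sigma> permutes {0..<n}" "\<mu> \<in> D"
  shows "mon_act \<sigma> \<mu> \<in> D"
proof -
  have i: "inv \<sigma> permutes {..<n}" using assms permutes_inv by (simp add: atLeast0LessThan)
  have bij: "bij \<sigma>" using assms permutes_bij by blast
  have ge: "inv \<sigma> r = r" if "n \<le> r" for r using permutes_not_in[OF i] that by simp
  have lt: "inv \<sigma> r < n \<longleftrightarrow> r < n" for r using permutes_in_image[OF i, of r] by simp
  have "(\<Sum>r<n. fst \<mu> (inv \<sigma> r) k) = (\<Sum>r<n. fst \<mu> r k)" for k
    using sum.permute[OF i, of "\<lambda>r. fst \<mu> r k"] by (simp add: o_def)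
  moreover have "card {r. (inv \<sigma> r, i) \<in> snd \<mu>} = card {r. (r, i) \<in> snd \<mu>}" for i
    by (rule bij_betw_same_card[of "inv \<sigma>"], rule bij_betwI[of _ _ _ \<sigma>])
      (use bij in \<open>auto simp: bij_is_inj surj_f_inv_f bij_is_surj\<close>)
  moreover have "(r, i) \<in> snd (mon_act \<sigma> \<mu>) \<Longrightarrow> r < n \<and> i < length \<beta>" for r i
    using assms(2) lt[of r] by (auto simp: snd_mon_act[OF bij] deg_monomials_def)
  moreover have "fst (mon_act \<sigma> \<mu>) = (\<lambda>r. fst \<mu> (inv \<sigma> r))" by (simp add: mon_act_def)
  ultimately show ?thesis
    using assms(2) ge
    by (auto simp: deg_monomials_def case_prod_unfold subset_iff snd_mon_act[OF bij])
qed

lemma mon_sign_comp: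
  assumes "\<sigma> permutes {0..<n}" "\<tau> permutes {0..<n}" "\<mu> \<in> D"
  shows "mon_sign (\<sigma> \<circ> \<tau>) \<mu> = mon_sign \<sigma> (mon_act \<tau> \<mu>) * mon_sign \<tau> \<mu>"
proof -
  \<comment> \<open>The row permutation lifted to theta indices; \<open>mon_sign\<close> becomes
    \<open>inv_sign\<close> for the lexicographic order on pairs, so the cocycle identity
    applies.\<close>
  define F where "F = (\<lambda>\<sigma> (r :: nat, i :: nat). (\<sigma> r :: nat, i))"
  have e: "mon_sign \<sigma> \<mu> = inv_sign (F \<sigma>) (snd \<mu>)" for \<sigma> \<mu>
    by (simp add: mon_sign_def inv_sign_def F_def case_prod_beta)
  have inj: "inj (F \<sigma>)" if "\<sigma> permutes {0..<n}" for \<sigma>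
    using permutes_inj[OF that] by (auto simp: inj_on_def F_def)
  have "F (\<sigma> \<circ> \<tau>) = F \<sigma> \<circ> F \<tau>" by (auto simp: F_def fun_eq_iff)
  moreover have "snd (mon_act \<tau> \<mu>) = F \<tau> ` snd \<mu>" by (simp add: mon_act_def F_def)
  ultimately show ?thesis
    unfolding e using inj[OF assms(1)] inj[OF assms(2)] finite_snd[OF assms(3)]
    by (simp add: inv_sign_comp inj_on_subset)
qed

text \<open>The inversions of the theta's contributed by a pair of rows \<open>r < s\<close> with
  \<open>\<sigma> s < \<sigma> r\<close> number \<open>c r * c s\<close>, where \<open>c\<close> counts the theta's in a row.\<close>

lemma mon_sign_eq:
  assumes "\<sigma> permutes {0..<n}" "\<mu> \<in> D"
  shows "mon_sign \<sigma> \<mu> = inv_sign \<sigma> (odd_rows \<mu>)"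
proof -
  define S where "S = snd \<mu>"
  define J where "J = {(r, s). r < n \<and> s < n \<and> r < s \<and> \<sigma> s < \<sigma> r}"
  define c where "c r = card {i. (r, i) \<in> S}" for r
  have inj: "\<sigma> r = \<sigma> s \<longleftrightarrow> r = s" for r s using permutes_inj[OF assms(1)] by (simp add: inj_eq)
  have S: "r < n" if "(r, i) \<in> S" for r i
    using assms(2) that by (auto simp: S_def deg_monomials_def)
  have finJ: "finite J" by (rule finite_subset[of _ "{..<n} \<times> {..<n}"]) (auto simp: J_def)
  have fini: "finite {i. (r, i) \<in> S}" for r
    using finite_snd[OF assms(2)] by (rule finite_subset[rotated, OF finite_imageI[of _ snd]]) (force simp: S_def)
  let ?I = "{(p, q). p \<in> S \<and> q \<in> S \<and> p < q \<and> (\<sigma> (fst q), snd q) < (\<sigma> (fst p), snd p)}"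
  let ?K = "Sigma J (\<lambda>(r, s). {i. (r, i) \<in> S} \<times> {j. (s, j) \<in> S})"
  \<comment> \<open>Theta's of the same row are never inverted: their rows stay equal and the second
    index decides.\<close>
  have "p < q \<and> (\<sigma> (fst q), snd q) < (\<sigma> (fst p), snd p) \<longleftrightarrow> fst p < fst q \<and> \<sigma> (fst q) < \<sigma> (fst p)" for p q :: "nat \<times> nat"
    using inj[of "fst p" "fst q"] by (cases p; cases q; cases "fst p = fst q") auto
  then have I: "?I = {(p, q). p \<in> S \<and> q \<in> S \<and> fst p < fst q \<and> \<sigma> (fst q) < \<sigma> (fst p)}" by auto
  define swap :: "(nat \<times> nat) \<times> nat \<times> nat \<Rightarrow> (nat \<times> nat) \<times> nat \<times> nat"
    where "swap = (\<lambda>((r, s), (i, j)). ((r, i), (s, j)))"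
  have "card ?I = card ?K"
    unfolding I
  proof (rule bij_betw_same_card, rule bij_betw_byWitness[where f = swap and f' = swap])
    show "\<forall>x\<in>{(p, q). p \<in> S \<and> q \<in> S \<and> fst p < fst q \<and> \<sigma> (fst q) < \<sigma> (fst p)}.
      swap (swap x) = x" by (auto simp: swap_def)
    show "\<forall>x\<in>?K. swap (swap x) = x" by (auto simp: swap_def)
    show "swap ` {(p, q). p \<in> S \<and> q \<in> S \<and> fst p < fst q \<and> \<sigma> (fst q) < \<sigma> (fst p)} \<subseteq> ?K"
      by (auto simp: J_def swap_def dest: S)
    show "swap ` ?K \<subseteq> {(p, q). p \<in> S \<and> q \<in> S \<and> fst p < fst q \<and> \<sigma> (fst q) < \<sigma> (fst p)}"
      by (auto simp: J_def swap_def)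
  qed
  also have "\<dots> = (\<Sum>x\<in>J. c (fst x) * c (snd x))"
    using finJ fini by (subst card_SigmaI) (auto simp: c_def card_cartesian_product intro!: sum.cong)
  finally have "mon_sign \<sigma> \<mu> = (\<Prod>x\<in>J. (-1) ^ (c (fst x) * c (snd x)))"
    by (simp add: mon_sign_def S_def[symmetric] power_sum)
  also have "\<dots> = (\<Prod>x\<in>J. if odd (c (fst x)) \<and> odd (c (snd x)) then -1 else 1)"
    by (rule prod.cong) (auto simp: minus_one_power_iff)
  also have "\<dots> = (-1) ^ card {x \<in> J. odd (c (fst x)) \<and> odd (c (snd x))}"
    using finJ by (simp add: prod.If_cases Int_def)
  also have "{x \<in> J. odd (c (fst x)) \<and> odd (c (snd x))} =
      {(p, q). p \<in> odd_rows \<mu> \<and> q \<in> odd_rows \<mu> \<and> p < q \<and> \<sigma> q < \<sigma> p}"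
    by (auto simp: J_def odd_rows_def num_barred_row_label c_def S_def)
  finally show ?thesis by (simp add: inv_sign_def)
qed

text \<open>Since \<open>mon_act \<sigma>\<close> permutes \<open>D\<close>, a single summand
  survives.\<close>

lemma comp_rep_apply:
  assumes "\<sigma> permutes {0..<n}"
  shows "comp_rep n \<alpha> \<beta> \<sigma> f \<nu> =
    (if \<nu> \<in> D then mon_sign \<sigma> (mon_act (inv \<sigma>) \<nu>) * f (mon_act (inv \<sigma>) \<nu>) else 0)"
proof -
  have bij: "bij \<sigma>" using assms permutes_bij by blast
  have "mon_act \<sigma> \<mu> = \<nu> \<longleftrightarrow> \<mu> = mon_act (inv \<sigma>) \<nu>" for \<mu>
    using mon_act_inv[OF bij] by metis
  then have "comp_rep n \<alpha> \<beta> \<sigma> f \<nu> = (if mon_act (inv \<sigma>) \<nu> \<in> D then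
      mon_sign \<sigma> (mon_act (inv \<sigma>) \<nu>) * f (mon_act (inv \<sigma>) \<nu>) else 0)"
    using finite_D by (simp add: comp_rep_def)
  moreover have "mon_act (inv \<sigma>) \<nu> \<in> D \<longleftrightarrow> \<nu> \<in> D"
    using mon_act_in_D[OF assms] mon_act_in_D[OF permutes_inv[OF assms]] mon_act_inv[OF bij] by metis
  ultimately show ?thesis by simp
qed

end

section \<open>Polytabloids and Garnir relations\<close>


lemma tab_rep_id: "tab_rep id f = f"
  by (simp add: tab_rep_def)

lemma sum_permutes_left:
  assumes "\<tau> permutes A"
  shows "(\<Sum>\<sigma> | \<sigma> permutes A. F (\<tau> \<circ> \<sigma>)) = (\<Sum>\<sigma> | \<sigma> permutes A. F \<sigma>)"
proof (rule sum.reindex_bij_witness[of _ "\<lambda>\<sigma>. inv \<tau> \<circ> \<sigma>" "\<lambda>\<sigma>. \<tau> \<circ> \<sigma>"])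
qed (use assms in \<open>auto simp: o_assoc permutes_inv_o permutes_compose permutes_inv\<close>)

lemma sum_permutes_right:
  assumes "\<tau> permutes A"
  shows "(\<Sum>\<sigma> | \<sigma> permutes A. F (\<sigma> \<circ> \<tau>)) = (\<Sum>\<sigma> | \<sigma> permutes A. F \<sigma>)"
proof (rule sum.reindex_bij_witness[of _ "\<lambda>\<sigma>. \<sigma> \<circ> inv \<tau>" "\<lambda>\<sigma>. \<sigma> \<circ> \<tau>"])
qed (use assms in \<open>auto simp: o_assoc[symmetric] permutes_inv_o permutes_compose permutes_inv\<close>)

lemma sign_comp_permutes:
  assumes "finite A" "\<sigma> permutes A" "\<tau> permutes A"
  shows "sign (\<sigma> \<circ> \<tau>) = sign \<sigma> * sign \<tau>"
  using assms by (intro sign_compose) (auto simp: permutation_permutes)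

lemma sign_inv_permutes: "finite A \<Longrightarrow> \<sigma> permutes A \<Longrightarrow> sign (inv \<sigma>) = sign \<sigma>"
  by (intro sign_inverse) (auto simp: permutation_permutes)

text \<open>Relative to one fixed tableau \<open>t0\<close>, tableaux become permutations and the
  Specht module becomes cyclic with generator \<open>e\<close>.\<close>

locale base_tableau =
  fixes n :: nat and la :: "nat list" and t0 :: "nat \<times> nat \<Rightarrow> nat"
  assumes part: "is_partition n la" and t0: "t0 \<in> tableaux la n"
begin

abbreviation perms :: "(nat \<Rightarrow> nat) set" where "perms \<equiv> {\<sigma>. \<sigma> permutes {0..<n}}"

definition pos :: "nat \<Rightarrow> nat \<times> nat" where "pos = inv_into (young_cells la) t0"
definition row :: "nat \<Rightarrow> nat" where "row k = fst (pos k)"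
definition col :: "nat \<Rightarrow> nat" where "col k = snd (pos k)"

definition tab0 :: "nat \<Rightarrow> nat" where "tab0 k = (if k < n then row k else 0)"

definition C :: "(nat \<Rightarrow> nat) set" where
  "C = {\<pi> \<in> perms. \<forall>k<n. col (\<pi> k) = col k}"

text \<open>\<open>inv \<pi>\<close> appears because a tabloid is stored as the row of each entry:
  moving the entries by \<open>\<pi>\<close> precomposes this function with
  \<open>inv \<pi>\<close>.\<close>

definition e :: "(nat \<Rightarrow> nat) \<Rightarrow> complex" where
  "e t = (\<Sum>\<pi>\<in>C. if tab0 \<circ> inv \<pi> = t then of_int (sign \<pi>) else 0)"

lemma finite_perms: "finite perms"
  by (simp add: finite_permutations)

lemma C_perms: "C \<subseteq> perms" and finite_C: "finite C"
  using finite_perms by (auto simp: C_def)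

lemma permsD: "\<pi> \<in> C \<Longrightarrow> \<pi> permutes {0..<n}"
  using C_perms by auto

lemma perm_less: "\<sigma> permutes {0..<n} \<Longrightarrow> \<sigma> k < n \<longleftrightarrow> k < n"
  using permutes_in_image[of \<sigma> "{0..<n}" k] by simp

lemma bij_t0: "bij_betw t0 (young_cells la) {0..<n}"
  using t0 by (simp add: tableaux_def)

lemma pos_in: "k < n \<Longrightarrow> pos k \<in> young_cells la" and t0_pos: "k < n \<Longrightarrow> t0 (pos k) = k"
  using bij_betw_imp_surj_on[OF bij_t0] by (auto simp: pos_def intro: inv_into_into f_inv_into_f)

lemma t0_less: "c \<in> young_cells la \<Longrightarrow> t0 c < n" and pos_t0: "c \<in> young_cells la \<Longrightarrow> pos (t0 c) = c"
  using bij_betw_apply[OF bij_t0] bij_betw_imp_inj_on[OF bij_t0] by (auto simp: pos_def)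

lemma row_col_inj: "j < n \<Longrightarrow> k < n \<Longrightarrow> row j = row k \<Longrightarrow> col j = col k \<Longrightarrow> j = k"
  by (metis row_def col_def prod_eqI t0_pos)

lemma cell_obtain:
  assumes "(i, j) \<in> young_cells la"
  obtains k where "k < n" "row k = i" "col k = j"
  using that[of "t0 (i, j)"] t0_less[OF assms] pos_t0[OF assms] by (simp add: row_def col_def)

lemma row_col_cell: "k < n \<Longrightarrow> (row k, col k) \<in> young_cells la"
  using pos_in by (simp add: row_def col_def)

lemma cells_left: "(i, j) \<in> young_cells la \<Longrightarrow> j' \<le> j \<Longrightarrow> (i, j') \<in> young_cells la"
  by (simp add: young_cells_def)

lemma cells_up:
  assumes "(i, j) \<in> young_cells la" "i' \<le> i"
  shows "(i', j) \<in> young_cells la"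
proof -
  have "la ! i \<le> la ! i'"
    using sorted_rev_nth_mono[of la i' i] part assms by (simp add: is_partition_def young_cells_def)
  then show ?thesis using assms by (simp add: young_cells_def)
qed

lemma tabloid_of_perm:
  assumes \<sigma>: "\<sigma> permutes {0..<n}" and T: "\<And>c. c \<in> young_cells la \<Longrightarrow> T c = \<sigma> (t0 c)"
  shows "tabloid_of la n T = tab0 \<circ> inv \<sigma>"
proof
  fix k
  show "tabloid_of la n T k = (tab0 \<circ> inv \<sigma>) k"
  proof (cases "k < n")
    case True
    then have k: "inv \<sigma> k < n" using perm_less[OF permutes_inv[OF \<sigma>]] by simp
    have "inj_on T (young_cells la)"
      using bij_betw_imp_inj_on[OF bij_t0] permutes_inj[OF \<sigma>] T by (auto simp: inj_on_def)
    moreover have "T (pos (inv \<sigma> k)) = k"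
      using T[OF pos_in[OF k]] t0_pos[OF k] permutes_inverses(1)[OF \<sigma>] by simp
    ultimately have "inv_into (young_cells la) T k = pos (inv \<sigma> k)"
      using pos_in[OF k] by (metis inv_into_f_eq)
    then show ?thesis using True k by (simp add: tabloid_of_def tab0_def row_def)
  next
    case False
    then show ?thesis using perm_less[OF permutes_inv[OF \<sigma>]] by (simp add: tabloid_of_def tab0_def)
  qed
qed

lemma col_stab_perm:
  assumes \<sigma>: "\<sigma> permutes {0..<n}" and T: "\<And>c. c \<in> young_cells la \<Longrightarrow> T c = \<sigma> (t0 c)"
  shows "col_stab la n T = (\<lambda>\<pi>. \<sigma> \<circ> \<pi> \<circ> inv \<sigma>) ` C"
proof -
  have \<sigma>': "inv \<sigma> permutes {0..<n}" using \<sigma> by (rule permutes_inv)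
  have inv: "\<sigma> (inv \<sigma> x) = x" "inv \<sigma> (\<sigma> x) = x" for x
    using permutes_inverses[OF \<sigma>] by auto
  have key: "(\<forall>c\<in>young_cells la. \<exists>c'\<in>young_cells la. snd c' = snd c \<and> T c' = \<pi> (T c)) \<longleftrightarrow>
      (\<forall>k<n. col (inv \<sigma> (\<pi> (\<sigma> k))) = col k)" if "\<pi> permutes {0..<n}" for \<pi>
  proof (intro iffI allI impI ballI)
    fix k assume *: "\<forall>c\<in>young_cells la. \<exists>c'\<in>young_cells la. snd c' = snd c \<and> T c' = \<pi> (T c)" and k: "k < n"
    then obtain c' where c': "c' \<in> young_cells la" "snd c' = col k" "T c' = \<pi> (T (pos k))"
      using pos_in[OF k] by (auto simp: col_def)
    then have "\<sigma> (t0 c') = \<pi> (\<sigma> k)" using T pos_in[OF k] t0_pos[OF k] by simp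
    then have "inv \<sigma> (\<pi> (\<sigma> k)) = t0 c'" using inv by metis
    then show "col (inv \<sigma> (\<pi> (\<sigma> k))) = col k" using c' pos_t0 by (simp add: col_def)
  next
    fix c assume *: "\<forall>k<n. col (inv \<sigma> (\<pi> (\<sigma> k))) = col k" and c: "c \<in> young_cells la"
    let ?k = "inv \<sigma> (\<pi> (\<sigma> (t0 c)))"
    have k: "?k < n" using perm_less[OF \<sigma>] perm_less[OF \<sigma>'] perm_less[OF that] t0_less[OF c] by simp
    show "\<exists>c'\<in>young_cells la. snd c' = snd c \<and> T c' = \<pi> (T c)"
    proof (intro bexI conjI)
      show "snd (pos ?k) = snd c" using * t0_less[OF c] pos_t0[OF c] by (simp add: col_def)
      show "T (pos ?k) = \<pi> (T c)" using T[OF pos_in[OF k]] t0_pos[OF k] inv T[OF c] by simp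
    qed (rule pos_in[OF k])
  qed
  show ?thesis
  proof (intro equalityI subsetI)
    fix \<pi> assume \<pi>: "\<pi> \<in> col_stab la n T"
    then have p: "\<pi> permutes {0..<n}" by (simp add: col_stab_def)
    have "inv \<sigma> \<circ> \<pi> \<circ> \<sigma> \<in> C"
      using \<pi> key[OF p] p \<sigma> \<sigma>' by (auto simp: C_def col_stab_def permutes_compose)
    moreover have "\<sigma> \<circ> (inv \<sigma> \<circ> \<pi> \<circ> \<sigma>) \<circ> inv \<sigma> = \<pi>" by (simp add: fun_eq_iff inv)
    ultimately show "\<pi> \<in> (\<lambda>\<pi>. \<sigma> \<circ> \<pi> \<circ> inv \<sigma>) ` C" by (metis (no_types, lifting) imageI)
  next
    fix \<pi> assume "\<pi> \<in> (\<lambda>\<pi>. \<sigma> \<circ> \<pi> \<circ> inv \<sigma>) ` C"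
    then obtain \<pi>' where \<pi>': "\<pi>' \<in> C" "\<pi> = \<sigma> \<circ> \<pi>' \<circ> inv \<sigma>" by auto
    have p: "\<pi> permutes {0..<n}" unfolding \<pi>'(2) using permsD[OF \<pi>'(1)] \<sigma> \<sigma>' by (intro permutes_compose)
    then show "\<pi> \<in> col_stab la n T" using key[OF p] \<pi>' by (auto simp: col_stab_def C_def inv)
  qed
qed

text \<open>Renaming the entries of \<open>t0\<close> by \<open>\<sigma>\<close> conjugates the
  column group, and signs are invariant under conjugation. Hence the translates of \<open>e\<close>
  span the Specht module.\<close>

lemma polytabloid_perm:
  assumes \<sigma>: "\<sigma> permutes {0..<n}" and T: "\<And>c. c \<in> young_cells la \<Longrightarrow> T c = \<sigma> (t0 c)"
  shows "polytabloid la n T = tab_rep \<sigma> e"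
proof
  fix t
  have inv: "\<sigma> (inv \<sigma> x) = x" "inv \<sigma> (\<sigma> x) = x" for x
    using permutes_inverses[OF \<sigma>] by auto
  have inj: "inj_on (\<lambda>\<pi>. \<sigma> \<circ> \<pi> \<circ> inv \<sigma>) C"
  proof (rule inj_onI)
    fix \<pi> \<pi>' assume "\<sigma> \<circ> \<pi> \<circ> inv \<sigma> = \<sigma> \<circ> \<pi>' \<circ> inv \<sigma>"
    then have "\<sigma> (\<pi> (inv \<sigma> (\<sigma> x))) = \<sigma> (\<pi>' (inv \<sigma> (\<sigma> x)))" for x by (metis comp_apply)
    then show "\<pi> = \<pi>'" using permutes_inj[OF \<sigma>] inv by (auto simp: inj_def)
  qed
  have "(if tabloid_of la n ((\<sigma> \<circ> \<pi> \<circ> inv \<sigma>) \<circ> T) = t then of_int (sign (\<sigma> \<circ> \<pi> \<circ> inv \<sigma>)) else 0) =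
    (if tab0 \<circ> inv \<pi> = t \<circ> \<sigma> then of_int (sign \<pi>) else (0 :: complex))" if "\<pi> \<in> C" for \<pi>
  proof -
    have \<pi>: "\<pi> permutes {0..<n}" using permsD[OF that] .
    have "tabloid_of la n ((\<sigma> \<circ> \<pi> \<circ> inv \<sigma>) \<circ> T) = tab0 \<circ> inv (\<sigma> \<circ> \<pi>)"
      by (rule tabloid_of_perm) (use \<pi> \<sigma> T inv in \<open>auto simp: permutes_compose\<close>)
    also have "\<dots> = tab0 \<circ> inv \<pi> \<circ> inv \<sigma>"
      using inv_comp_permutes[OF \<sigma> \<pi>] by (simp add: o_assoc)
    finally have "tabloid_of la n ((\<sigma> \<circ> \<pi> \<circ> inv \<sigma>) \<circ> T) = t \<longleftrightarrow> tab0 \<circ> inv \<pi> = t \<circ> \<sigma>"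
      using inv by (auto simp: fun_eq_iff) metis
    moreover have "sign (\<sigma> \<circ> \<pi> \<circ> inv \<sigma>) = sign \<pi>"
      using sign_comp_permutes[of "{0..<n}"] sign_inv_permutes[of "{0..<n}"] \<sigma> \<pi>
      by (simp add: permutes_compose permutes_inv)
    ultimately show ?thesis by simp
  qed
  then show "polytabloid la n T t = tab_rep \<sigma> e t"
    by (simp add: polytabloid_def col_stab_perm[OF \<sigma> T] sum.reindex[OF inj] tab_rep_def e_def)
qed

lemma specht_eq: "specht la n = {(\<lambda>t. \<Sum>\<sigma>\<in>perms. c \<sigma> * tab_rep \<sigma> e t) | c. True}"
proof -
  \<comment> \<open>\<open>F\<close> and \<open>G\<close> are mutually inverse bijections between
    permutations and tableaux; the default values \<open>0\<close> and \<open>k\<close> are those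
    that \<open>tableaux\<close> and \<open>permutes\<close> demand.\<close>
  define F where "F = (\<lambda>\<sigma> :: nat \<Rightarrow> nat. \<lambda>c. if c \<in> young_cells la then \<sigma> (t0 c) else (0::nat))"
  define G where "G = (\<lambda>T :: nat \<times> nat \<Rightarrow> nat. \<lambda>k. if k < n then T (pos k) else k)"
  have F: "F \<sigma> \<in> tableaux la n" if "\<sigma> permutes {0..<n}" for \<sigma>
  proof -
    have "bij_betw (\<sigma> \<circ> t0) (young_cells la) {0..<n}"
      by (rule bij_betw_trans[OF bij_t0 permutes_imp_bij[OF that]])
    then have "bij_betw (F \<sigma>) (young_cells la) {0..<n}"
      by (rule bij_betw_cong[THEN iffD1, rotated]) (simp add: F_def)
    then show ?thesis by (simp add: tableaux_def F_def)
  qed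
  have G: "G T permutes {0..<n}" if "T \<in> tableaux la n" for T
  proof -
    have "bij_betw (T \<circ> pos) {0..<n} {0..<n}"
      using that bij_betw_inv_into[OF bij_t0]
      by (auto simp: tableaux_def pos_def intro: bij_betw_trans)
    then have "bij_betw (G T) {0..<n} {0..<n}"
      by (rule bij_betw_cong[THEN iffD1, rotated]) (simp add: G_def)
    then show ?thesis by (rule bij_imp_permutes) (simp add: G_def)
  qed
  have GF: "G (F \<sigma>) = \<sigma>" if "\<sigma> permutes {0..<n}" for \<sigma>
    using that pos_in t0_pos permutes_not_in[OF that] by (auto simp: G_def F_def fun_eq_iff)
  have FG: "F (G T) = T" if "T \<in> tableaux la n" for T
    using that t0_less pos_t0 by (auto simp: G_def F_def fun_eq_iff tableaux_def)
  have poly: "polytabloid la n (F \<sigma>) = tab_rep \<sigma> e" if "\<sigma> permutes {0..<n}" for \<sigma>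
    by (rule polytabloid_perm[OF that]) (simp add: F_def)
  have "(\<Sum>T\<in>tableaux la n. c T * polytabloid la n T t) = (\<Sum>\<sigma>\<in>perms. c (F \<sigma>) * tab_rep \<sigma> e t)" for c t
    by (rule sum.reindex_bij_witness[of _ F G]) (use F G GF FG poly in \<open>auto simp: poly[symmetric]\<close>)
  moreover have "(\<Sum>\<sigma>\<in>perms. c \<sigma> * tab_rep \<sigma> e t) = (\<Sum>\<sigma>\<in>perms. c (G (F \<sigma>)) * tab_rep \<sigma> e t)" for c t
    using GF by simp
  ultimately have e1: "(\<lambda>t. \<Sum>T\<in>tableaux la n. c T * polytabloid la n T t) = (\<lambda>t. \<Sum>\<sigma>\<in>perms. c (F \<sigma>) * tab_rep \<sigma> e t)"
    and e2: "(\<lambda>t. \<Sum>\<sigma>\<in>perms. d \<sigma> * tab_rep \<sigma> e t) = (\<lambda>t. \<Sum>T\<in>tableaux la n. d (G T) * polytabloid la n T t)" for c d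
    by simp_all
  show ?thesis unfolding specht_def
  proof (intro equalityI subsetI)
    fix f assume "f \<in> {(\<lambda>t. \<Sum>T\<in>tableaux la n. c T * polytabloid la n T t) | c. True}"
    then obtain c where "f = (\<lambda>t. \<Sum>\<sigma>\<in>perms. c (F \<sigma>) * tab_rep \<sigma> e t)" using e1 by auto
    then show "f \<in> {(\<lambda>t. \<Sum>\<sigma>\<in>perms. c \<sigma> * tab_rep \<sigma> e t) | c. True}"
      by (intro CollectI exI[of _ "c \<circ> F"]) simp
  next
    fix f assume "f \<in> {(\<lambda>t. \<Sum>\<sigma>\<in>perms. c \<sigma> * tab_rep \<sigma> e t) | c. True}"
    then obtain c where "f = (\<lambda>t. \<Sum>\<sigma>\<in>perms. c \<sigma> * tab_rep \<sigma> e t)" by auto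
    then have "f = (\<lambda>t. \<Sum>T\<in>tableaux la n. c (G T) * polytabloid la n T t)" by (simp only: e2)
    then show "f \<in> {(\<lambda>t. \<Sum>T\<in>tableaux la n. c T * polytabloid la n T t) | c. True}"
      by (intro CollectI exI[of _ "c \<circ> G"]) simp
  qed
qed

lemma spechtI: "(\<lambda>t. \<Sum>\<sigma>\<in>perms. c \<sigma> * tab_rep \<sigma> e t) \<in> specht la n"
  by (auto simp: specht_eq)

lemma spechtE:
  assumes "f \<in> specht la n"
  obtains c where "f = (\<lambda>t. \<Sum>\<sigma>\<in>perms. c \<sigma> * tab_rep \<sigma> e t)"
  using assms by (auto simp: specht_eq)

lemma tab_rep_e_in:
  assumes "\<tau> permutes {0..<n}"
  shows "tab_rep \<tau> e \<in> specht la n"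
proof -
  have "(\<Sum>\<sigma>\<in>perms. (if \<sigma> = \<tau> then 1 else 0) * tab_rep \<sigma> e t) = tab_rep \<tau> e t" for t
  proof -
    have "(\<Sum>\<sigma>\<in>perms. (if \<sigma> = \<tau> then 1 else 0) * tab_rep \<sigma> e t) = (\<Sum>\<sigma>\<in>perms. if \<sigma> = \<tau> then tab_rep \<sigma> e t else 0)"
      by (rule sum.cong) auto
    also have "\<dots> = (if \<tau> \<in> perms then tab_rep \<tau> e t else 0)" by (rule sum.delta[OF finite_perms])
    finally show ?thesis using assms by simp
  qed
  then show ?thesis using spechtI[of "\<lambda>\<sigma>. if \<sigma> = \<tau> then 1 else 0"] by simp
qed

lemma e_in: "e \<in> specht la n"
  using tab_rep_e_in[OF permutes_id] by (simp add: tab_rep_id)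

lemma specht_add: "f \<in> specht la n \<Longrightarrow> g \<in> specht la n \<Longrightarrow> (\<lambda>t. f t + g t) \<in> specht la n"
  by (elim spechtE) (simp add: sum.distrib[symmetric] distrib_right[symmetric] spechtI)

lemma specht_scale: "f \<in> specht la n \<Longrightarrow> (\<lambda>t. c * f t) \<in> specht la n"
  by (elim spechtE) (simp add: sum_distrib_left mult.assoc[symmetric] spechtI)

lemma specht_zero: "(\<lambda>t. 0) \<in> specht la n"
  using specht_scale[OF e_in, of 0] by simp

lemma specht_sum:
  assumes "\<And>i. i \<in> I \<Longrightarrow> f i \<in> specht la n"
  shows "(\<lambda>t. \<Sum>i\<in>I. c i * f i t) \<in> specht la n"
  using assms
proof (induction I rule: infinite_finite_induct)
  case (insert x F)
  then have "(\<lambda>t. c x * f x t + (\<Sum>i\<in>F. c i * f i t)) \<in> specht la n"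
    by (intro specht_add specht_scale) auto
  then show ?case using insert by simp
qed (simp_all add: specht_zero)

lemma specht_tab_rep:
  assumes "f \<in> specht la n" "\<tau> permutes {0..<n}"
  shows "tab_rep \<tau> f \<in> specht la n"
proof -
  obtain c where f: "f = (\<lambda>t. \<Sum>\<sigma>\<in>perms. c \<sigma> * tab_rep \<sigma> e t)" using assms(1) by (elim spechtE)
  have "tab_rep \<tau> f = (\<lambda>t. \<Sum>\<sigma>\<in>perms. c \<sigma> * tab_rep (\<tau> \<circ> \<sigma>) e t)"
    unfolding f by (simp add: tab_rep_def o_assoc)
  also have "\<dots> \<in> specht la n"
    by (rule specht_sum) (use assms(2) in \<open>auto intro!: tab_rep_e_in permutes_compose\<close>)
  finally show ?thesis .
qed

lemma C_comp: "\<pi> \<in> C \<Longrightarrow> \<tau> \<in> C \<Longrightarrow> \<pi> \<circ> \<tau> \<in> C"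
  using perm_less by (auto simp: C_def permutes_compose)

lemma C_inv:
  assumes "\<pi> \<in> C" shows "inv \<pi> \<in> C"
proof -
  have p: "\<pi> permutes {0..<n}" using permsD[OF assms] .
  have "col (inv \<pi> k) = col k" if "k < n" for k
    using assms perm_less[OF permutes_inv[OF p], of k] that permutes_inverses(1)[OF p, of k]
    by (metis (mono_tags, lifting) C_def mem_Collect_eq)
  then show ?thesis using p by (simp add: C_def permutes_inv)
qed

text \<open>Left multiplication by \<open>\<pi>\<close> permutes the terms of \<open>e\<close> and
  changes each sign by \<open>sign \<pi>\<close>.\<close>

lemma tab_rep_C:
  assumes "\<pi> \<in> C"
  shows "tab_rep \<pi> e = (\<lambda>t. of_int (sign \<pi>) * e t)"
proof
  fix t
  have \<pi>: "\<pi> permutes {0..<n}" using permsD[OF assms] .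
  have inv: "\<pi> (inv \<pi> x) = x" "inv \<pi> (\<pi> x) = x" for x
    using permutes_inverses[OF \<pi>] by auto
  have "tab_rep \<pi> e t = (\<Sum>\<tau>\<in>C. if tab0 \<circ> inv (\<pi> \<circ> \<tau>) = t then of_int (sign \<tau>) else 0)"
    unfolding tab_rep_def e_def
  proof (rule sum.cong[OF refl])
    fix \<tau> assume "\<tau> \<in> C"
    then have "tab0 \<circ> inv (\<pi> \<circ> \<tau>) = tab0 \<circ> inv \<tau> \<circ> inv \<pi>"
      using inv_comp_permutes[OF \<pi> permsD] by (simp add: o_assoc)
    then have "tab0 \<circ> inv (\<pi> \<circ> \<tau>) = t \<longleftrightarrow> tab0 \<circ> inv \<tau> = t \<circ> \<pi>"
      using inv by (auto simp: fun_eq_iff) metis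
    then show "(if tab0 \<circ> inv \<tau> = t \<circ> \<pi> then of_int (sign \<tau>) else 0) =
      (if tab0 \<circ> inv (\<pi> \<circ> \<tau>) = t then of_int (sign \<tau>) else (0::complex))" by simp
  qed
  also have "\<dots> = (\<Sum>\<tau>\<in>C. if tab0 \<circ> inv \<tau> = t then of_int (sign \<pi> * sign \<tau>) else 0)"
  proof (rule sum.reindex_bij_witness[of _ "\<lambda>\<tau>. inv \<pi> \<circ> \<tau>" "\<lambda>\<tau>. \<pi> \<circ> \<tau>"])
    fix \<tau> assume \<tau>: "\<tau> \<in> C"
    show "inv \<pi> \<circ> (\<pi> \<circ> \<tau>) = \<tau>" "\<pi> \<circ> (inv \<pi> \<circ> \<tau>) = \<tau>" by (auto simp: fun_eq_iff inv)
    show "\<pi> \<circ> \<tau> \<in> C" "inv \<pi> \<circ> \<tau> \<in> C" using C_comp C_inv assms \<tau> by auto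
    show "(if tab0 \<circ> inv (\<pi> \<circ> \<tau>) = t then of_int (sign \<pi> * sign (\<pi> \<circ> \<tau>)) else 0) =
         (if tab0 \<circ> inv (\<pi> \<circ> \<tau>) = t then of_int (sign \<tau>) else (0::complex))"
      using sign_comp_permutes[OF _ \<pi> permsD[OF \<tau>]] by simp
  qed
  also have "\<dots> = of_int (sign \<pi>) * e t"
    by (simp add: e_def sum_distrib_left if_distrib cong: if_cong)
  finally show "tab_rep \<pi> e t = of_int (sign \<pi>) * e t" .
qed

text \<open>The Garnir belt: the lower part of one column and the upper part of the next. Both parts
  contain row \<open>i\<close>, and this overlap is what the pigeonhole argument exploits.\<close>

definition garnir :: "nat \<Rightarrow> nat \<Rightarrow> nat set" where
  "garnir i j = {k. k < n \<and> (col k = j \<and> i \<le> row k \<or> col k = Suc j \<and> row k \<le> i)}"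

text \<open>A Garnir set has more elements than the longer of its two columns has rows.\<close>

lemma garnir_pigeonhole:
  assumes cell: "(i, Suc j) \<in> young_cells la" and \<pi>: "\<pi> \<in> C"
  shows "\<exists>a\<in>garnir i j. \<exists>b\<in>garnir i j. a \<noteq> b \<and> row (inv \<pi> a) = row (inv \<pi> b)"
proof (rule ccontr)
  assume "\<not> ?thesis"
  then have inj: "inj_on (\<lambda>k. row (inv \<pi> k)) (garnir i j)" by (auto simp: inj_on_def)
  define R where "R = {r. (r, j) \<in> young_cells la}"
  define A where "A = {k. k < n \<and> col k = j \<and> i \<le> row k}"
  define B where "B = {k. k < n \<and> col k = Suc j \<and> row k \<le> i}"
  have finR: "finite R" by (rule finite_subset[of _ "{..<length la}"]) (auto simp: R_def young_cells_def)
  have fin: "finite A" "finite B" by (auto simp: A_def B_def)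
  have "(\<lambda>k. row (inv \<pi> k)) ` garnir i j \<subseteq> R"
  proof
    fix r assume "r \<in> (\<lambda>k. row (inv \<pi> k)) ` garnir i j"
    then obtain k where k: "k \<in> garnir i j" "r = row (inv \<pi> k)" by auto
    then have kn: "k < n" "col k = j \<or> col k = Suc j" by (auto simp: garnir_def)
    have "inv \<pi> k < n" "col (inv \<pi> k) = col k"
      using C_inv[OF \<pi>] perm_less[OF permsD[OF C_inv[OF \<pi>]]] kn(1) by (auto simp: C_def)
    then have "(r, col k) \<in> young_cells la" using row_col_cell[of "inv \<pi> k"] k(2) by simp
    then show "r \<in> R" using cells_left[of r "col k" j] kn(2) by (auto simp: R_def)
  qed
  then have le: "card (garnir i j) \<le> card R"
    using card_inj_on_le[OF inj _ finR] by simp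
  have "garnir i j = A \<union> B" "A \<inter> B = {}" by (auto simp: garnir_def A_def B_def)
  then have "card (garnir i j) = card A + card B" using fin by (simp add: card_Un_disjoint)
  also have "card A = card (row ` A)" by (rule card_image[symmetric]) (auto simp: A_def inj_on_def intro: row_col_inj)
  also have "card B = card (row ` B)" by (rule card_image[symmetric]) (auto simp: B_def inj_on_def intro: row_col_inj)
  \<comment> \<open>The union covers every row of column \<open>j\<close>, and row \<open>i\<close>
    is hit by both parts, so the total exceeds the number of available rows.\<close>
  also have "card (row ` A) + card (row ` B) = card (row ` A \<union> row ` B) + card (row ` A \<inter> row ` B)"
    using fin by (intro card_Un_Int) auto
  finally have "card (row ` A \<union> row ` B) + card (row ` A \<inter> row ` B) \<le> card R" using le by simp
  moreover have "R \<subseteq> row ` A \<union> row ` B"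
  proof
    fix r assume r: "r \<in> R"
    show "r \<in> row ` A \<union> row ` B"
    proof (cases "i \<le> r")
      case True
      obtain k where "k < n" "row k = r" "col k = j" using r cell_obtain[of r j] by (auto simp: R_def)
      then show ?thesis using True by (auto simp: A_def)
    next
      case False
      then have "(r, Suc j) \<in> young_cells la" using cells_up[OF cell, of r] by simp
      then obtain k where "k < n" "row k = r" "col k = Suc j" by (elim cell_obtain)
      then show ?thesis using False by (auto simp: B_def)
    qed
  qed
  then have "card R \<le> card (row ` A \<union> row ` B)" using fin by (intro card_mono) auto
  moreover have "i \<in> row ` A \<inter> row ` B"
  proof -
    obtain k where "k < n" "row k = i" "col k = Suc j" using cell by (elim cell_obtain)
    moreover obtain k' where "k' < n" "row k' = i" "col k' = j"
      using cells_left[OF cell, of j] by (auto elim: cell_obtain)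
    ultimately have "k' \<in> A" "k \<in> B" "row k' = i" "row k = i" by (auto simp: A_def B_def)
    then show ?thesis by (metis IntI imageI)
  qed
  then have "0 < card (row ` A \<inter> row ` B)" using fin by (auto simp: card_gt_0_iff)
  ultimately show False by simp
qed

text \<open>For each \<open>\<pi>\<close> in \<open>C\<close> two entries of the Garnir set share a
  row of the permuted tabloid. Their transposition \<open>\<tau>\<close> fixes that tabloid, so the
  terms of \<open>\<sigma>\<close> and \<open>\<sigma> \<circ> \<tau>\<close> cancel. Summing over
  the full symmetric group avoids choosing coset representatives.\<close>

lemma garnir_relation:
  assumes "(i, Suc j) \<in> young_cells la"
  shows "(\<Sum>\<sigma> | \<sigma> permutes garnir i j. of_int (sign \<sigma>) * tab_rep \<sigma> e t) = 0"
proof -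
  let ?G = "garnir i j"
  have sub: "?G \<subseteq> {0..<n}" by (auto simp: garnir_def)
  have fin: "finite ?G" using sub finite_subset by blast
  have "(\<Sum>\<sigma> | \<sigma> permutes ?G. of_int (sign \<sigma>) * (if tab0 \<circ> inv \<pi> = t \<circ> \<sigma> then of_int (sign \<pi>) else 0)) = (0::complex)"
    (is "sum ?F _ = 0") if \<pi>: "\<pi> \<in> C" for \<pi>
  proof -
    obtain a b where ab: "a \<in> ?G" "b \<in> ?G" "a \<noteq> b" "row (inv \<pi> a) = row (inv \<pi> b)"
      using garnir_pigeonhole[OF assms \<pi>] by blast
    define \<tau> where "\<tau> = transpose a b"
    have \<tau>: "\<tau> permutes ?G" unfolding \<tau>_def using ab by (intro permutes_swap_id)
    have "inv \<pi> a < n" "inv \<pi> b < n"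
      using perm_less[OF permsD[OF C_inv[OF \<pi>]]] ab sub by auto
    then have tau: "tab0 (inv \<pi> (\<tau> x)) = tab0 (inv \<pi> x)" for x
      using ab(4) by (auto simp: \<tau>_def transpose_def tab0_def)
    have \<tau>\<tau>: "\<tau> (\<tau> x) = x" for x by (simp add: \<tau>_def)
    have "?F (\<sigma> \<circ> \<tau>) = - ?F \<sigma>" if "\<sigma> permutes ?G" for \<sigma>
    proof -
      have "tab0 \<circ> inv \<pi> = t \<circ> (\<sigma> \<circ> \<tau>) \<longleftrightarrow> tab0 \<circ> inv \<pi> = t \<circ> \<sigma>"
        unfolding fun_eq_iff o_apply using tau \<tau>\<tau> by metis
      moreover have "sign (\<sigma> \<circ> \<tau>) = - sign \<sigma>"
        using sign_comp_permutes[OF fin that \<tau>] ab(3) by (simp add: \<tau>_def sign_swap_id)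
      ultimately show ?thesis by simp
    qed
    then have "sum ?F {\<sigma>. \<sigma> permutes ?G} = - sum ?F {\<sigma>. \<sigma> permutes ?G}"
      by (subst sum_permutes_right[OF \<tau>, symmetric]) (simp add: sum_negf)
    then show ?thesis by simp
  qed
  then have "(\<Sum>\<pi>\<in>C. \<Sum>\<sigma> | \<sigma> permutes ?G. of_int (sign \<sigma>) * (if tab0 \<circ> inv \<pi> = t \<circ> \<sigma> then of_int (sign \<pi>) else 0)) = (0::complex)"
    by simp
  then show ?thesis
    by (subst (asm) sum.swap) (simp add: tab_rep_def e_def sum_distrib_left)
qed

end

section \<open>Homomorphisms are determined on multiset tableaux\<close>


lemma ms_less_irrefl: "\<not> ms_less x x"
  by (simp add: ms_less_def lexord_irreflexive)

lemma ms_less_trans: "ms_less x y \<Longrightarrow> ms_less y z \<Longrightarrow> ms_less x z"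
  unfolding ms_less_def by (rule lexord_trans) (auto simp: trans_def)

lemma ms_less_linear: "ms_less x y \<or> x = y \<or> ms_less y x"
proof -
  have "(sorted_list_of_multiset x, sorted_list_of_multiset y) \<in> lexord {(x, y). x < y} \<or>
    sorted_list_of_multiset x = sorted_list_of_multiset y \<or>
    (sorted_list_of_multiset y, sorted_list_of_multiset x) \<in> lexord {(x, y). x < y}"
    by (rule lexord_linear) auto
  then show ?thesis unfolding ms_less_def by (metis mset_sorted_list_of_multiset)
qed

text \<open>The swap adds \<open>(h s - h r) * (f r - f s)\<close>, which is positive.\<close>

lemma sum_transpose_less:
  fixes f h :: "'a \<Rightarrow> nat"
  assumes "finite P" "r \<in> P" "s \<in> P" "h r < h s" "f s < f r"
  shows "(\<Sum>k\<in>P. h k * f k) < (\<Sum>k\<in>P. h k * f (transpose r s k))"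
proof -
  have split: "sum F P = F r + F s + sum F (P - {r} - {s})" for F :: "'a \<Rightarrow> nat"
    using sum.remove[OF assms(1,2), of F] sum.remove[of "P - {r}" s F] assms by fastforce
  have "(\<Sum>k\<in>P - {r} - {s}. h k * f (transpose r s k)) = (\<Sum>k\<in>P - {r} - {s}. h k * f k)"
    by (rule sum.cong) auto
  moreover obtain d where d: "h s = Suc (h r + d)" using assms(4) less_iff_Suc_add by auto
  moreover obtain e where e: "f r = Suc (f s + e)" using assms(5) less_iff_Suc_add by auto
  have "h r * f r + h s * f s < h r * f s + h s * f r" unfolding d e by (simp add: algebra_simps)
  ultimately show ?thesis by (subst (1 2) split) simp
qed

locale tableau_module = graded_piece n \<alpha> \<beta> + base_tableau n la t0
  for n \<alpha> \<beta> la t0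
begin

definition labels :: "letter multiset set" where
  "labels = (\<lambda>(\<mu>, r). lab \<mu> r) ` (D \<times> {0..<n})"

text \<open>Replaces the multiset order on the labels that occur by natural numbers, so that labels
  can be weighted and summed.\<close>

definition rank :: "letter multiset \<Rightarrow> nat" where
  "rank x = card {y \<in> labels. ms_less y x}"

abbreviation rk :: "monomial \<Rightarrow> nat \<Rightarrow> nat" where "rk \<mu> r \<equiv> rank (lab \<mu> r)"

definition \<Phi> :: "monomial \<Rightarrow> nat" where "\<Phi> \<mu> = (\<Sum>k\<in>{0..<n}. col k * rk \<mu> k)"
text \<open>The tie-breaker: among column rearrangements of a monomial, all with the same
  \<open>\<Phi>\<close>, it is largest when ranks increase down the columns.\<close>

definition \<Psi> :: "monomial \<Rightarrow> nat" where "\<Psi> \<mu> = (\<Sum>k\<in>{0..<n}. row k * rk \<mu> k)"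

definition filling :: "monomial \<Rightarrow> nat \<times> nat \<Rightarrow> letter multiset" where
  "filling \<mu> c = (if c \<in> young_cells la then lab \<mu> (t0 c) else {#})"

definition SS :: "monomial set" where
  "SS = {\<mu> \<in> D. is_multiset_tableau la (filling \<mu>)}"

lemma lab_labels: "\<mu> \<in> D \<Longrightarrow> r < n \<Longrightarrow> lab \<mu> r \<in> labels"
  by (force simp: labels_def)

lemma finite_labels: "finite labels"
  using finite_D by (simp add: labels_def)

lemma rank_less: "x \<in> labels \<Longrightarrow> ms_less x y \<Longrightarrow> rank x < rank y"
  unfolding rank_def using finite_labels ms_less_irrefl
  by (intro psubset_card_mono) (auto intro: ms_less_trans)

lemma rank_eq: "x \<in> labels \<Longrightarrow> y \<in> labels \<Longrightarrow> rank x = rank y \<longleftrightarrow> x = y"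
  using rank_less ms_less_linear by (metis less_irrefl)

lemma rank_le: "x \<in> labels \<Longrightarrow> y \<in> labels \<Longrightarrow> rank x \<le> rank y \<longleftrightarrow> ms_le x y"
  using rank_less ms_less_linear ms_less_irrefl ms_less_trans
  by (metis leD less_or_eq_imp_le ms_le_def order_refl)

lemma rk_eq: "\<mu> \<in> D \<Longrightarrow> r < n \<Longrightarrow> s < n \<Longrightarrow> rk \<mu> r = rk \<mu> s \<longleftrightarrow> lab \<mu> r = lab \<mu> s"
  by (simp add: rank_eq lab_labels)

lemma monomial_eqI:
  assumes "\<mu> \<in> D" "\<nu> \<in> D" "\<And>r. r < n \<Longrightarrow> rk \<mu> r = rk \<nu> r"
  shows "\<mu> = \<nu>"
  using assms by (intro lab_inj[of \<mu> \<nu>]) (auto simp: rank_eq lab_labels)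

lemma odd_rows_cong:
  "\<mu> \<in> D \<Longrightarrow> r < n \<Longrightarrow> s < n \<Longrightarrow> rk \<mu> r = rk \<mu> s \<Longrightarrow> r \<in> odd_rows \<mu> \<longleftrightarrow> s \<in> odd_rows \<mu>"
  by (simp add: rk_eq odd_rows_def)

lemma rk_act:
  assumes "\<sigma> permutes {0..<n}"
  shows "rk (mon_act \<sigma> \<mu>) k = rk \<mu> (inv \<sigma> k)" "rk (mon_act (inv \<sigma>) \<mu>) k = rk \<mu> (\<sigma> k)"
  using assms permutes_bij[OF assms] by (simp_all add: lab_act bij_imp_bij_inv inv_inv_eq)

text \<open>The tableau conditions transported from cells to entries of \<open>t0\<close> and from
  the multiset order to ranks, the form in which rearrangement arguments can use them.\<close>

lemma SS_iff:
  "\<mu> \<in> SS \<longleftrightarrow> \<mu> \<in> D \<and>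
    (\<forall>r<n. \<forall>s<n. row s = row r \<and> col s = Suc (col r) \<longrightarrow> rk \<mu> r \<le> rk \<mu> s) \<and>
    (\<forall>r<n. \<forall>s<n. col s = col r \<and> row s = Suc (row r) \<longrightarrow> rk \<mu> r \<le> rk \<mu> s) \<and>
    (\<forall>r<n. \<forall>s<n. r \<noteq> s \<and> rk \<mu> r = rk \<mu> s \<and> r \<notin> odd_rows \<mu> \<longrightarrow> col r \<noteq> col s) \<and>
    (\<forall>r<n. \<forall>s<n. r \<noteq> s \<and> rk \<mu> r = rk \<mu> s \<and> r \<in> odd_rows \<mu> \<longrightarrow> row r \<noteq> row s)"
proof (cases "\<mu> \<in> D")
  case True
  have cells: "(\<forall>c\<in>young_cells la. P c) \<longleftrightarrow> (\<forall>r<n. P (row r, col r))" for P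
    using pos_in t0_less pos_t0 unfolding row_def col_def prod.collapse by metis
  have fill: "filling \<mu> (row r, col r) = lab \<mu> r" if "r < n" for r
    using row_col_cell[OF that] t0_pos[OF that] by (simp add: filling_def row_def col_def)
  \<comment> \<open>Column neighbours are the offset \<open>(1, 0)\<close>, row neighbours the
    offset \<open>(0, 1)\<close>.\<close>
  have adj: "(\<forall>i j. (i, j) \<in> young_cells la \<and> (i + a, j + b) \<in> young_cells la \<longrightarrow>
      ms_le (filling \<mu> (i, j)) (filling \<mu> (i + a, j + b))) \<longleftrightarrow>
    (\<forall>r<n. \<forall>s<n. row s = row r + a \<and> col s = col r + b \<longrightarrow> rk \<mu> r \<le> rk \<mu> s)"
    (is "?L \<longleftrightarrow> ?R") for a b
  proof
    assume L: ?L
    show ?R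
    proof (intro allI impI)
      fix r s assume *: "r < n" "s < n" "row s = row r + a \<and> col s = col r + b"
      then have "ms_le (filling \<mu> (row r, col r)) (filling \<mu> (row r + a, col r + b))"
        using L row_col_cell by metis
      then have "ms_le (lab \<mu> r) (lab \<mu> s)" using fill[of r] fill[of s] * by simp
      then show "rk \<mu> r \<le> rk \<mu> s" using * True by (simp add: rank_le lab_labels)
    qed
  next
    assume R: ?R
    show ?L
    proof (intro allI impI)
      fix i j assume c: "(i, j) \<in> young_cells la \<and> (i + a, j + b) \<in> young_cells la"
      obtain r where r: "r < n" "row r = i" "col r = j" using c by (auto elim: cell_obtain)
      obtain s where s: "s < n" "row s = i + a" "col s = j + b" using c by (auto elim: cell_obtain)
      have "ms_le (lab \<mu> r) (lab \<mu> s)" using R r s True by (simp add: rank_le[symmetric] lab_labels)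
      then show "ms_le (filling \<mu> (i, j)) (filling \<mu> (i + a, j + b))"
        using fill[of r] fill[of s] r s by simp
    qed
  qed
  have dist: "(\<forall>c\<in>young_cells la. \<forall>d\<in>young_cells la. c \<noteq> d \<and> filling \<mu> c = filling \<mu> d \<and> P (filling \<mu> c) \<longrightarrow> Q c d) \<longleftrightarrow>
     (\<forall>r<n. \<forall>s<n. r \<noteq> s \<and> rk \<mu> r = rk \<mu> s \<and> P (lab \<mu> r) \<longrightarrow> Q (row r, col r) (row s, col s))" for P Q
  proof -
    have "(row r, col r) \<noteq> (row s, col s) \<longleftrightarrow> r \<noteq> s" if "r < n" "s < n" for r s
      using that row_col_inj by auto
    then show ?thesis unfolding cells using fill rk_eq[OF True] by (metis (no_types, lifting))
  qed
  \<comment> \<open>Condition (1) mirrors the vanishing squares of the theta's: the theta part of a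
    monomial is a set.\<close>
  have cnt: "(\<forall>c\<in>young_cells la. \<forall>i. count (filling \<mu> c) (True, i) \<le> 1) \<longleftrightarrow> True"
    using count_row_label(2)[OF finite_snd[OF True]] by (simp add: filling_def)
  have odd: "r \<in> odd_rows \<mu> \<longleftrightarrow> odd (num_barred (lab \<mu> r))" if "r < n" for r
    using that by (simp add: odd_rows_def)
  have e1: "(\<forall>i j. (i, j) \<in> young_cells la \<and> (i + 1, j) \<in> young_cells la \<longrightarrow> ms_le (filling \<mu> (i, j)) (filling \<mu> (i + 1, j))) \<longleftrightarrow>
      (\<forall>r<n. \<forall>s<n. col s = col r \<and> row s = Suc (row r) \<longrightarrow> rk \<mu> r \<le> rk \<mu> s)"
    using adj[of 1 0] by (simp add: conj_commute)
  have e2: "(\<forall>i j. (i, j) \<in> young_cells la \<and> (i, j + 1) \<in> young_cells la \<longrightarrow> ms_le (filling \<mu> (i, j)) (filling \<mu> (i, j + 1))) \<longleftrightarrow>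
      (\<forall>r<n. \<forall>s<n. row s = row r \<and> col s = Suc (col r) \<longrightarrow> rk \<mu> r \<le> rk \<mu> s)"
    using adj[of 0 1] by simp
  have e3: "(\<forall>c\<in>young_cells la. \<forall>d\<in>young_cells la. c \<noteq> d \<and> filling \<mu> c = filling \<mu> d \<and> even (num_barred (filling \<mu> c))
         \<longrightarrow> snd c \<noteq> snd d) \<longleftrightarrow>
      (\<forall>r<n. \<forall>s<n. r \<noteq> s \<and> rk \<mu> r = rk \<mu> s \<and> r \<notin> odd_rows \<mu> \<longrightarrow> col r \<noteq> col s)"
    by (subst dist) (simp add: odd)
  have e4: "(\<forall>c\<in>young_cells la. \<forall>d\<in>young_cells la. c \<noteq> d \<and> filling \<mu> c = filling \<mu> d \<and> odd (num_barred (filling \<mu> c))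
         \<longrightarrow> fst c \<noteq> fst d) \<longleftrightarrow>
      (\<forall>r<n. \<forall>s<n. r \<noteq> s \<and> rk \<mu> r = rk \<mu> s \<and> r \<in> odd_rows \<mu> \<longrightarrow> row r \<noteq> row s)"
    by (subst dist) (simp add: odd)
  show ?thesis
    unfolding SS_def mem_Collect_eq is_multiset_tableau_def e1 e2 e3 e4 cnt
    by (simp only: True simp_thms conj_ac)
qed (simp add: SS_def)

lemma SS_D: "\<mu> \<in> SS \<Longrightarrow> \<mu> \<in> D"
  by (simp add: SS_def)

text \<open>Chains the neighbour inequalities; the intermediate cells exist because a diagram is
  closed to the left.\<close>

lemma row_mono:
  assumes "\<And>r s. r < n \<Longrightarrow> s < n \<Longrightarrow> row s = row r \<Longrightarrow> col s = Suc (col r) \<Longrightarrow> (f r :: nat) \<le> f s"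
    and "r < n" "s < n" "row s = row r" "col r \<le> col s"
  shows "f r \<le> f s"
  using assms(3-5)
proof (induction "col s - col r" arbitrary: s)
  case 0
  then have "row s = row r" "col s = col r" by linarith+
  then have "s = r" using 0 assms(2) row_col_inj by blast
  then show ?case by simp
next
  case (Suc d)
  then have "(row s, col s - 1) \<in> young_cells la" using cells_left[OF row_col_cell[of s]] by simp
  then obtain k where k: "k < n" "row k = row s" "col k = col s - 1" by (elim cell_obtain)
  have "f r \<le> f k" using Suc.hyps(1)[of k] Suc.hyps(2) Suc.prems k by simp
  also have "f k \<le> f s" using assms(1)[of k s] Suc k by simp
  finally show ?case .
qed

lemma col_mono:
  assumes "\<And>r s. r < n \<Longrightarrow> s < n \<Longrightarrow> col s = col r \<Longrightarrow> row s = Suc (row r) \<Longrightarrow> (f r :: nat) \<le> f s"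
    and "r < n" "s < n" "col s = col r" "row r \<le> row s"
  shows "f r \<le> f s"
  using assms(3-5)
proof (induction "row s - row r" arbitrary: s)
  case 0
  then have "row s = row r" "col s = col r" by linarith+
  then have "s = r" using 0 assms(2) row_col_inj by blast
  then show ?case by simp
next
  case (Suc d)
  then have "(row s - 1, col s) \<in> young_cells la" using cells_up[OF row_col_cell[of s]] by simp
  then obtain k where k: "k < n" "row k = row s - 1" "col k = col s" by (elim cell_obtain)
  have "f r \<le> f k" using Suc.hyps(1)[of k] Suc.hyps(2) Suc.prems k by simp
  also have "f k \<le> f s" using assms(1)[of k s] Suc k by simp
  finally show ?case .
qed

lemma mon_act_eq_self:
  assumes "\<sigma> permutes {0..<n}" "\<mu> \<in> D" "\<And>k. k < n \<Longrightarrow> rk \<mu> (\<sigma> k) = rk \<mu> k"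
  shows "mon_act (inv \<sigma>) \<mu> = \<mu>" "mon_act \<sigma> \<mu> = \<mu>"
proof -
  show *: "mon_act (inv \<sigma>) \<mu> = \<mu>"
    using assms by (intro monomial_eqI) (auto simp: rk_act(2) mon_act_in_D permutes_inv)
  show "mon_act \<sigma> \<mu> = \<mu>"
    using mon_act_inv(1)[OF permutes_bij[OF assms(1)], of \<mu>] * by simp
qed

text \<open>Together with \<open>mon_sign_fixed\<close>: odd rows anticommute like single theta's,
  while the other rows commute with everything.\<close>

lemma mon_sign_permutes:
  assumes "\<sigma> permutes {0..<n}" "\<mu> \<in> D" "\<sigma> permutes P" "P \<subseteq> odd_rows \<mu>"
  shows "mon_sign \<sigma> \<mu> = of_int (sign \<sigma>)"
  using mon_sign_eq[OF assms(1,2)] inv_sign_permutes[OF assms(3,4)] by (simp add: odd_rows_def)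

lemma mon_sign_fixed:
  assumes "\<sigma> permutes {0..<n}" "\<mu> \<in> D" "\<And>k. k \<in> odd_rows \<mu> \<Longrightarrow> \<sigma> k = k"
  shows "mon_sign \<sigma> \<mu> = 1"
  using mon_sign_eq[OF assms(1,2)] inv_sign_fixed[of "odd_rows \<mu>" \<sigma>] assms(3) by simp

end

text \<open>The known properties of \<open>v = \<phi> e\<close>, abstracted from the homomorphism;
  \<open>supp\<close> says that \<open>v\<close> lies in the graded component.\<close>

locale garnir_vector = tableau_module +
  fixes v :: "monomial \<Rightarrow> complex"
  assumes supp: "\<nu> \<notin> D \<Longrightarrow> v \<nu> = 0"
    and alt: "\<pi> \<in> C \<Longrightarrow> comp_rep n \<alpha> \<beta> \<pi> v \<nu> = of_int (sign \<pi>) * v \<nu>"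
    and garnir: "(i, Suc j) \<in> young_cells la \<Longrightarrow>
      (\<Sum>\<sigma> | \<sigma> permutes garnir i j. of_int (sign \<sigma>) * comp_rep n \<alpha> \<beta> \<sigma> v \<nu>) = 0"
begin

lemma alt_apply:
  assumes "\<pi> \<in> C" "\<nu> \<in> D"
  shows "mon_sign \<pi> (mon_act (inv \<pi>) \<nu>) * v (mon_act (inv \<pi>) \<nu>) = of_int (sign \<pi>) * v \<nu>"
  using alt[OF assms(1), of \<nu>] comp_rep_apply[OF permsD[OF assms(1)], of v \<nu>] assms(2) by simp

lemma nonzero_act:
  assumes "\<pi> \<in> C" "\<nu> \<in> D" "v \<nu> \<noteq> 0"
  shows "v (mon_act (inv \<pi>) \<nu>) \<noteq> 0"
  using alt_apply[OF assms(1,2)] assms(3) by auto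

lemma transpose_C: "r < n \<Longrightarrow> s < n \<Longrightarrow> col r = col s \<Longrightarrow> transpose r s \<in> C"
  using permutes_swap_id[of r "{0..<n}" s] by (auto simp: C_def transpose_def)

text \<open>Swapping two equal even labels fixes the monomial with sign \<open>+1\<close>, while
  alternation under a column transposition demands \<open>-1\<close>; so
  \<open>v \<mu> = - v \<mu>\<close>.\<close>

lemma no_even_repeat:
  assumes "\<mu> \<in> D" "v \<mu> \<noteq> 0" "r < n" "s < n" "r \<noteq> s" "rk \<mu> r = rk \<mu> s" "r \<notin> odd_rows \<mu>"
  shows "col r \<noteq> col s"
proof
  assume "col r = col s"
  then have C: "transpose r s \<in> C" using assms by (intro transpose_C)
  then have p: "transpose r s permutes {0..<n}" by (rule permsD)
  have "mon_act (inv (transpose r s)) \<mu> = \<mu>"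
    using assms by (intro mon_act_eq_self[OF p]) (auto simp: transpose_def)
  moreover have "mon_sign (transpose r s) \<mu> = 1"
    using assms odd_rows_cong[of \<mu> r s] by (intro mon_sign_fixed[OF p]) (auto simp: transpose_def)
  ultimately have "v \<mu> = - v \<mu>"
    using alt_apply[OF C assms(1)] \<open>r \<noteq> s\<close> by (simp add: sign_swap_id)
  then show False using assms(2) by simp
qed

text \<open>If the rows of \<open>\<mu>\<close> fail to increase at \<open>r, s\<close>, every term of the Garnir relation at \<open>\<mu>\<close>
  involves either a monomial with larger \<open>\<Phi>\<close>, or the coefficient of \<open>\<mu>\<close> with sign \<open>+1\<close>.\<close>

lemma no_garnir_descent:
  assumes \<mu>: "\<mu> \<in> D" "v \<mu> \<noteq> 0" and max: "\<And>\<nu>. \<nu> \<in> D \<Longrightarrow> \<Phi> \<mu> < \<Phi> \<nu> \<Longrightarrow> v \<nu> = 0"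
    and mono: "\<And>r s. r < n \<Longrightarrow> s < n \<Longrightarrow> col s = col r \<Longrightarrow> row r \<le> row s \<Longrightarrow> rk \<mu> r \<le> rk \<mu> s"
    and rs: "r < n" "s < n" "row s = row r" "col s = Suc (col r)"
    and desc: "rk \<mu> s \<le> rk \<mu> r" "rk \<mu> r = rk \<mu> s \<Longrightarrow> r \<in> odd_rows \<mu>"
  shows False
proof -
  define G where "G = garnir (row r) (col r)"
  define f where "f = rk \<mu>"
  \<comment> \<open>The indicator of the left column. On the Garnir set \<open>col k + h k\<close>
    is constant, so lowering the \<open>h\<close>-weighted sum of ranks means raising
    \<open>\<Phi>\<close>.\<close>
  define h where "h k = (if col k = col r then 1 else 0 :: nat)" for k
  \<comment> \<open>Left-hand ranks are at least \<open>f r\<close> and right-hand ranks at most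
    \<open>f s\<close>. With \<open>f s \<le> f r\<close> no right-hand rank exceeds a left-hand
    one, so \<open>\<mu>\<close> is already optimal for the weight \<open>h\<close>.\<close>
  have G: "k < n" "col k = col r \<and> f r \<le> f k \<or> col k = Suc (col r) \<and> f k \<le> f s" if "k \<in> G" for k
    using that mono[of r k] mono[of k s] rs by (auto simp: G_def garnir_def f_def)
  have sub: "G \<subseteq> {0..<n}" using G by auto
  have fin: "finite G" using sub finite_subset by blast
  have perm: "\<sigma> permutes {0..<n}" if "\<sigma> permutes G" for \<sigma> using that sub by (rule permutes_subset)
  have desc': "f s \<le> f r" using desc by (simp add: f_def)
  \<comment> \<open>Equal ranks in one column are odd by \<open>no_even_repeat\<close>; equal ranks
    across the two columns are squeezed to \<open>f r = f s\<close>, which is odd by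
    hypothesis.\<close>
  have odd: "x \<in> odd_rows \<mu>" if "x \<in> G" "y \<in> G" "x \<noteq> y" "f x = f y" for x y
  proof (cases "col x = col y")
    case True
    then show ?thesis using no_even_repeat[OF \<mu>, of x y] that G by (auto simp: f_def)
  next
    case False
    then have "f x = f r" "f r = f s" using G[OF that(1)] G[OF that(2)] that(4) desc' by auto
    then show ?thesis using desc(2) odd_rows_cong[OF \<mu>(1) _ rs(1)] G(1)[OF that(1)] by (simp add: f_def)
  qed
  define Q where "Q \<sigma> \<longleftrightarrow> (\<Sum>k\<in>G. h k * f (\<sigma> k)) = (\<Sum>k\<in>G. h k * f k)" for \<sigma>
  have summand: "of_int (sign \<sigma>) * comp_rep n \<alpha> \<beta> \<sigma> v \<mu> = (if Q \<sigma> then v \<mu> else 0)"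
    if \<sigma>: "\<sigma> permutes G" for \<sigma>
  proof -
    note \<sigma>n = perm[OF \<sigma>]
    note rearr = rearrangement[OF fin \<sigma>, where g = "\<lambda>_. ()" and h = h and f = f]
    have "f x \<le> f y" if "x \<in> G" "y \<in> G" "h x < h y" for x y
      using G[OF that(1)] G[OF that(2)] that(3) desc' by (auto simp: h_def split: if_splits)
    then have le: "(\<Sum>k\<in>G. h k * f (\<sigma> k)) \<le> (\<Sum>k\<in>G. h k * f k)"
      and ex: "Q \<sigma> \<Longrightarrow> \<exists>\<pi>. \<pi> permutes G \<and> (\<forall>r\<in>G. h (\<pi> r) = h r \<and> f (\<sigma> (\<pi> r)) = f r)"
      using rearr unfolding Q_def by auto
    have ap: "comp_rep n \<alpha> \<beta> \<sigma> v \<mu> = mon_sign \<sigma> (mon_act (inv \<sigma>) \<mu>) * v (mon_act (inv \<sigma>) \<mu>)"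
      using comp_rep_apply[OF \<sigma>n] \<mu> by simp
    show ?thesis
    proof (cases "Q \<sigma>")
      case False
      have sG: "(\<Sum>k\<in>G. col k * F k) + (\<Sum>k\<in>G. h k * F k) = Suc (col r) * (\<Sum>k\<in>G. F k)" for F
        unfolding sum.distrib[symmetric] sum_distrib_left
        by (rule sum.cong) (auto simp: h_def dest: G(2))
      have "(\<Sum>k\<in>G. f (\<sigma> k)) = (\<Sum>k\<in>G. f k)"
        using sum.permute[OF \<sigma>, of f] by (simp add: o_def)
      then have "(\<Sum>k\<in>G. col k * f (\<sigma> k)) + (\<Sum>k\<in>G. h k * f (\<sigma> k)) = (\<Sum>k\<in>G. col k * f k) + (\<Sum>k\<in>G. h k * f k)"
        using sG[of f] sG[of "\<lambda>k. f (\<sigma> k)"] by simp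
      then have "(\<Sum>k\<in>G. col k * f k) < (\<Sum>k\<in>G. col k * f (\<sigma> k))"
        using le False by (simp add: Q_def)
      moreover have "(\<Sum>k\<in>{0..<n} - G. col k * f (\<sigma> k)) = (\<Sum>k\<in>{0..<n} - G. col k * f k)"
        by (rule sum.cong) (auto simp: permutes_not_in[OF \<sigma>])
      ultimately have "\<Phi> \<mu> < \<Phi> (mon_act (inv \<sigma>) \<mu>)"
        using sum.subset_diff[OF sub, of "\<lambda>k. col k * f (\<sigma> k)"] sum.subset_diff[OF sub, of "\<lambda>k. col k * f k"]
        by (simp add: \<Phi>_def rk_act[OF \<sigma>n] f_def)
      then have "v (mon_act (inv \<sigma>) \<mu>) = 0"
        by (rule max[rotated]) (rule mon_act_in_D[OF permutes_inv[OF \<sigma>n] \<mu>(1)])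
      then show ?thesis using ap False by simp
    next
      case True
      \<comment> \<open>The equality case factors \<open>\<sigma>\<close> as
        \<open>\<tau> \<circ> inv \<pi>\<close>, with \<open>\<tau>\<close> preserving labels and
        \<open>\<pi>\<close> preserving columns, since \<open>h\<close> tells the two columns
        apart.\<close>
      then obtain \<pi> where \<pi>: "\<pi> permutes G" "\<And>k. k \<in> G \<Longrightarrow> h (\<pi> k) = h k" "\<And>k. k \<in> G \<Longrightarrow> f (\<sigma> (\<pi> k)) = f k"
        using ex by auto
      note \<pi>n = perm[OF \<pi>(1)]
      have "col (\<pi> k) = col k" for k
      proof (cases "k \<in> G")
        case True
        then have "\<pi> k \<in> G" using permutes_in_image[OF \<pi>(1)] by simp
        then show ?thesis using True \<pi>(2)[OF True] G(2)[of k] G(2)[of "\<pi> k"] by (auto simp: h_def split: if_splits)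
      qed (simp add: permutes_not_in[OF \<pi>(1)])
      then have \<pi>C: "\<pi> \<in> C" using \<pi>n by (simp add: C_def)
      define \<tau> where "\<tau> = \<sigma> \<circ> \<pi>"
      have \<tau>: "\<tau> permutes G" unfolding \<tau>_def using \<pi>(1) \<sigma> by (rule permutes_compose)
      note \<tau>n = perm[OF \<tau>]
      have f\<tau>: "f (\<tau> k) = f k" for k
        using \<pi>(3)[of k] permutes_not_in[OF \<tau>] by (cases "k \<in> G") (auto simp: \<tau>_def)
      have self: "mon_act (inv \<tau>) \<mu> = \<mu>"
        using mon_act_eq_self(1)[OF \<tau>n \<mu>(1)] f\<tau> by (simp add: f_def)
      \<comment> \<open>An even label is unique in the Garnir set, so \<open>\<tau>\<close> fixes
        its entry.\<close>
      have "\<tau> permutes (G \<inter> odd_rows \<mu>)"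
      proof (rule permutes_superset[OF \<tau>])
        fix k assume k: "k \<in> G - G \<inter> odd_rows \<mu>"
        then have "\<tau> k \<in> G" using permutes_in_image[OF \<tau>] by simp
        then show "\<tau> k = k" using odd[of k "\<tau> k"] f\<tau>[of k] k by fastforce
      qed
      then have sgn\<tau>: "mon_sign \<tau> \<mu> = of_int (sign \<tau>)"
        by (rule mon_sign_permutes[OF \<tau>n \<mu>(1)]) simp
      define \<nu> where "\<nu> = mon_act \<pi> \<mu>"
      have \<nu>: "\<nu> \<in> D" unfolding \<nu>_def by (rule mon_act_in_D[OF \<pi>n \<mu>(1)])
      have bij: "bij \<pi>" "bij \<tau>" "bij \<sigma>" using \<pi>n \<tau>n \<sigma>n permutes_bij by auto
      have \<sigma>eq: "\<sigma> = \<tau> \<circ> inv \<pi>" unfolding \<tau>_def by (simp add: o_assoc[symmetric] permutes_inv_o[OF \<pi>n])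
      have "inv \<sigma> = \<pi> \<circ> inv \<tau>"
        unfolding \<sigma>eq using bij by (simp add: o_inv_distrib bij_imp_bij_inv inv_inv_eq)
      then have act: "mon_act (inv \<sigma>) \<mu> = \<nu>"
        using bij self by (simp add: mon_act_comp bij_imp_bij_inv \<nu>_def)
      have undo: "mon_act (inv \<pi>) \<nu> = \<mu>" unfolding \<nu>_def by (rule mon_act_inv(2)[OF bij(1)])
      \<comment> \<open>\<open>\<tau>\<close> contributes its sign because it moves odd rows only,
        and \<open>inv \<pi>\<close> contributes \<open>sign \<pi>\<close> by alternation. The
        product is \<open>sign \<sigma>\<close>, which cancels the sign in the Garnir sum.\<close>
      have "mon_sign \<sigma> \<nu> = mon_sign \<tau> \<mu> * mon_sign (inv \<pi>) \<nu>"
        unfolding \<sigma>eq using mon_sign_comp[OF \<tau>n permutes_inv[OF \<pi>n] \<nu>] undo by simp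
      moreover have "mon_sign (inv \<pi>) \<nu> * v \<nu> = of_int (sign \<pi>) * v \<mu>"
        using alt_apply[OF C_inv[OF \<pi>C] \<mu>(1)] sign_inv_permutes[OF fin \<pi>(1)] bij
        by (simp add: inv_inv_eq \<nu>_def)
      moreover have "sign \<tau> = sign \<sigma> * sign \<pi>"
        unfolding \<tau>_def by (rule sign_comp_permutes[OF fin \<sigma> \<pi>(1)])
      ultimately have "comp_rep n \<alpha> \<beta> \<sigma> v \<mu> = of_int (sign \<sigma> * (sign \<pi> * sign \<pi>)) * v \<mu>"
        using ap act sgn\<tau> by (simp del: sign_idempotent sign_left_idempotent)
      moreover have "sign \<sigma> * (sign \<sigma> * (sign \<pi> * sign \<pi>)) = 1" by (simp add: mult.assoc[symmetric])
      ultimately show ?thesis using True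
        by (metis mult.assoc mult_1 of_int_1 of_int_mult)
    qed
  qed
  have cell: "(row r, Suc (col r)) \<in> young_cells la" using row_col_cell[OF rs(2)] rs by simp
  have "(\<Sum>\<sigma> | \<sigma> permutes G. if Q \<sigma> then v \<mu> else 0) = 0"
    using garnir[OF cell, of \<mu>] summand by (simp add: G_def)
  moreover have finG: "finite {\<sigma>. \<sigma> permutes G}" using fin by (rule finite_permutations)
  \<comment> \<open>All surviving terms equal \<open>v \<mu>\<close>, so they cannot cancel; the
    identity survives, hence their number is a nonzero scalar.\<close>
  ultimately have "of_nat (card {\<sigma> \<in> {\<sigma>. \<sigma> permutes G}. Q \<sigma>}) * v \<mu> = 0"
    by (simp add: sum.inter_filter[OF finG, symmetric])
  moreover have "card {\<sigma> \<in> {\<sigma>. \<sigma> permutes G}. Q \<sigma>} \<noteq> 0"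
  proof -
    have "id \<in> {\<sigma> \<in> {\<sigma>. \<sigma> permutes G}. Q \<sigma>}" by (simp add: Q_def permutes_id)
    moreover have "finite {\<sigma> \<in> {\<sigma>. \<sigma> permutes G}. Q \<sigma>}" using finG by simp
    ultimately show ?thesis using card_0_eq by blast
  qed
  ultimately show False using \<mu>(2) by simp
qed

text \<open>Otherwise take a monomial with nonzero coefficient, \<open>\<Phi>\<close> maximal and
  then \<open>\<Psi>\<close> maximal. Maximality forces it to be a multiset tableau.\<close>

lemma zero_if_zero_on_SS:
  assumes "\<And>\<mu>. \<mu> \<in> SS \<Longrightarrow> v \<mu> = 0"
  shows "v \<nu> = 0"
proof (rule ccontr)
  assume "v \<nu> \<noteq> 0"
  define X where "X = {\<mu> \<in> D. v \<mu> \<noteq> 0}"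
  define X' where "X' = {\<mu> \<in> X. \<Phi> \<mu> = Max (\<Phi> ` X)}"
  have X: "finite X" "\<nu> \<in> X" using finite_D supp[of \<nu>] \<open>v \<nu> \<noteq> 0\<close> unfolding X_def by (simp, blast)
  then have "Max (\<Phi> ` X) \<in> \<Phi> ` X" by (intro Max_in) auto
  then obtain \<kappa> where "\<kappa> \<in> X" "\<Phi> \<kappa> = Max (\<Phi> ` X)" by auto
  then have X': "finite X'" "X' \<noteq> {}" using X unfolding X'_def by (simp, blast)
  then have "Max (\<Psi> ` X') \<in> \<Psi> ` X'" by (intro Max_in) auto
  then obtain \<mu> where \<mu>X: "\<mu> \<in> X'" and "\<Psi> \<mu> = Max (\<Psi> ` X')" by auto
  then have \<Psi>max: "\<Psi> \<kappa> \<le> \<Psi> \<mu>" if "\<kappa> \<in> X'" for \<kappa> using that X' by simp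
  have \<mu>: "\<mu> \<in> D" "v \<mu> \<noteq> 0" using \<mu>X by (auto simp: X'_def X_def)
  have \<Phi>max: "v \<kappa> = 0" if "\<kappa> \<in> D" "\<Phi> \<mu> < \<Phi> \<kappa>" for \<kappa>
  proof (rule ccontr)
    assume "v \<kappa> \<noteq> 0"
    then have "\<Phi> \<kappa> \<le> Max (\<Phi> ` X)" using that(1) X(1) by (simp add: X_def)
    then show False using that \<mu>X by (simp add: X'_def)
  qed
  \<comment> \<open>Swapping a descent in a column keeps \<open>\<Phi>\<close> and changes the
    coefficient by a sign only, but raises \<open>\<Psi>\<close>.\<close>
  have col_adj: "rk \<mu> r \<le> rk \<mu> s" if rs: "r < n" "s < n" "col s = col r" "row s = Suc (row r)" for r s
  proof (rule ccontr)
    assume "\<not> rk \<mu> r \<le> rk \<mu> s"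
    define \<pi> where "\<pi> = transpose r s"
    have \<pi>: "\<pi> \<in> C" unfolding \<pi>_def using rs by (intro transpose_C) auto
    note \<pi>n = permsD[OF \<pi>]
    let ?\<kappa> = "mon_act (inv \<pi>) \<mu>"
    have \<kappa>: "?\<kappa> \<in> D" "v ?\<kappa> \<noteq> 0"
      using mon_act_in_D[OF permutes_inv[OF \<pi>n] \<mu>(1)] nonzero_act[OF \<pi> \<mu>] by auto
    have "\<Phi> ?\<kappa> = (\<Sum>k\<in>{0..<n}. col (\<pi> k) * rk \<mu> (\<pi> k))"
      unfolding \<Phi>_def rk_act(2)[OF \<pi>n] using \<pi> by (intro sum.cong) (auto simp: C_def)
    also have "\<dots> = \<Phi> \<mu>" unfolding \<Phi>_def using sum.permute[OF \<pi>n, of "\<lambda>k. col k * rk \<mu> k"] by (simp add: o_def)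
    finally have "?\<kappa> \<in> X'" using \<kappa> \<mu>X by (simp add: X'_def X_def)
    then have "\<Psi> ?\<kappa> \<le> \<Psi> \<mu>" by (rule \<Psi>max)
    moreover have "\<Psi> \<mu> < \<Psi> ?\<kappa>"
      unfolding \<Psi>_def rk_act(2)[OF \<pi>n] unfolding \<pi>_def
      by (rule sum_transpose_less) (use rs \<open>\<not> rk \<mu> r \<le> rk \<mu> s\<close> in auto)
    ultimately show False by simp
  qed
  have cols: "rk \<mu> r \<le> rk \<mu> s" if "r < n" "s < n" "col s = col r" "row r \<le> row s" for r s
    by (rule col_mono[of "rk \<mu>", OF col_adj that])
  have strict: "rk \<mu> r < rk \<mu> s \<or> rk \<mu> r = rk \<mu> s \<and> r \<notin> odd_rows \<mu>" (is ?S)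
    if "r < n" "s < n" "row s = row r" "col s = Suc (col r)" for r s
  proof (rule ccontr)
    assume "\<not> ?S"
    then have d1: "rk \<mu> s \<le> rk \<mu> r" and d2: "rk \<mu> r = rk \<mu> s \<Longrightarrow> r \<in> odd_rows \<mu>" by linarith+
    show False by (rule no_garnir_descent[OF \<mu> \<Phi>max cols that d1 d2])
  qed
  have row_adj: "rk \<mu> r \<le> rk \<mu> s" if "r < n" "s < n" "row s = row r" "col s = Suc (col r)" for r s
    using strict[OF that] by linarith
  have rows: "rk \<mu> r \<le> rk \<mu> s" if "r < n" "s < n" "row s = row r" "col r \<le> col s" for r s
    by (rule row_mono[of "rk \<mu>", OF row_adj that])
  \<comment> \<open>By \<open>strict\<close> the right neighbour of \<open>r\<close> already has a
    larger rank, and ranks do not drop again on the way to \<open>s\<close>.\<close>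
  have odd: False if rs: "r < n" "s < n" "row s = row r" "col r < col s" "rk \<mu> r = rk \<mu> s" "r \<in> odd_rows \<mu>" for r s
  proof -
    have "(row r, Suc (col r)) \<in> young_cells la"
      using cells_left[OF row_col_cell[OF rs(2)], of "Suc (col r)"] rs by simp
    then obtain k where k: "k < n" "row k = row r" "col k = Suc (col r)" by (elim cell_obtain)
    then show False using strict[of r k] rows[of k s] rs by simp
  qed
  have "\<mu> \<in> SS"
    unfolding SS_iff
  proof (intro conjI allI impI)
    fix r s assume *: "r < n" "s < n" "r \<noteq> s \<and> rk \<mu> r = rk \<mu> s \<and> r \<in> odd_rows \<mu>"
    show "row r \<noteq> row s"
    proof
      assume "row r = row s"
      moreover from this have "col r < col s \<or> col s < col r" using row_col_inj[of r s] * by linarith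
      ultimately show False using odd[of r s] odd[of s r] odd_rows_cong[of \<mu> r s] * \<mu> by auto
    qed
  qed (use \<mu> rows cols no_even_repeat[OF \<mu>] in auto)
  then show False using assms \<mu> by simp
qed

end

section \<open>Semistandard homomorphisms\<close>


text \<open>At an index \<open>y\<close> with \<open>F y\<close> maximal the equation involves only
  the diagonal entry. It determines the coefficient \<open>d\<close>, whose contribution is moved to
  the right-hand sides of the other equations.\<close>

lemma triangular_solve:
  fixes M :: "'a \<Rightarrow> 'a \<Rightarrow> complex" and F :: "'a \<Rightarrow> nat"
  assumes "finite I" "\<And>x. x \<in> I \<Longrightarrow> M x x \<noteq> 0"
    and "\<And>x y. x \<in> I \<Longrightarrow> y \<in> I \<Longrightarrow> x \<noteq> y \<Longrightarrow> \<not> F x < F y \<Longrightarrow> M x y = 0"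
  shows "\<exists>c. \<forall>x\<in>I. (\<Sum>y\<in>I. c y * M x y) = g x"
  using assms
proof (induction "card I" arbitrary: I g)
  case 0
  then show ?case by simp
next
  case (Suc m)
  then have "I \<noteq> {}" by auto
  then have "Max (F ` I) \<in> F ` I" using Suc.prems by (intro Max_in) auto
  then obtain y where y: "y \<in> I" "F y = Max (F ` I)" by auto
  then have max: "F x \<le> F y" if "x \<in> I" for x using that Suc.prems(1) by simp
  define d where "d = g y / M y y"
  have "\<exists>c. \<forall>x\<in>I - {y}. (\<Sum>z\<in>I - {y}. c z * M x z) = g x - d * M x y"
    by (rule Suc.hyps(1)) (use Suc y in auto)
  then obtain c where c: "\<forall>x\<in>I - {y}. (\<Sum>z\<in>I - {y}. c z * M x z) = g x - d * M x y" by auto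
  have "(\<Sum>z\<in>I. (c(y := d)) z * M x z) = g x" if x: "x \<in> I" for x
  proof -
    have "(\<Sum>z\<in>I. (c(y := d)) z * M x z) = d * M x y + (\<Sum>z\<in>I - {y}. (c(y := d)) z * M x z)"
      by (subst sum.remove[OF Suc.prems(1) y(1)]) simp
    also have "(\<Sum>z\<in>I - {y}. (c(y := d)) z * M x z) = (\<Sum>z\<in>I - {y}. c z * M x z)"
      by (rule sum.cong) auto
    also have "d * M x y + \<dots> = g x"
    proof (cases "x = y")
      case True
      have "M y z = 0" if "z \<in> I - {y}" for z
        using Suc.prems(3)[of y z] y(1) max[of z] that by auto
      then show ?thesis using Suc.prems(2)[OF y(1)] True by (simp add: d_def)
    qed (use c x in simp)
    finally show ?thesis .
  qed
  then show ?case by blast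
qed

text \<open>Among the indices with nonzero coefficient take one with maximal \<open>F\<close>: its
  equation reduces to the diagonal term.\<close>

lemma triangular_unique:
  fixes M :: "'a \<Rightarrow> 'a \<Rightarrow> complex" and F :: "'a \<Rightarrow> nat"
  assumes "finite I" "\<And>x. x \<in> I \<Longrightarrow> M x x \<noteq> 0"
    and "\<And>x y. x \<in> I \<Longrightarrow> y \<in> I \<Longrightarrow> x \<noteq> y \<Longrightarrow> \<not> F x < F y \<Longrightarrow> M x y = 0"
    and sol: "\<And>x. x \<in> I \<Longrightarrow> (\<Sum>y\<in>I. c y * M x y) = 0" and "x \<in> I"
  shows "c x = 0"
proof (rule ccontr)
  assume "c x \<noteq> 0"
  define J where "J = {y \<in> I. c y \<noteq> 0}"
  have J: "finite J" "J \<noteq> {}" using assms(1,5) \<open>c x \<noteq> 0\<close> by (auto simp: J_def)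
  then have "Max (F ` J) \<in> F ` J" by (intro Max_in) auto
  then obtain y where y: "y \<in> J" "F y = Max (F ` J)" by auto
  have "c z * M y z = 0" if "z \<in> I - {y}" for z
  proof (cases "z \<in> J")
    case True
    then have "F z \<le> F y" using y J by simp
    then show ?thesis using assms(3)[of y z] y(1) that by (auto simp: J_def)
  next
    case False
    then show ?thesis using that by (simp add: J_def)
  qed
  then have "(\<Sum>z\<in>I - {y}. c z * M y z) = 0" by (rule sum.neutral[OF ballI])
  then have "(\<Sum>z\<in>I. c z * M y z) = c y * M y y"
    using sum.remove[OF assms(1), of y "\<lambda>z. c z * M y z"] y(1) by (simp add: J_def)
  then show False using sol[of y] assms(2)[of y] y(1) by (simp add: J_def)
qed

context tableau_module
begin

text \<open>Up to a scalar, \<open>\<psi> \<mu>\<close> sends the tabloid of \<open>t0\<close> to the sum of \<open>\<mu>\<close> over the row stabiliser; no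
  explicit symmetrisation is needed because \<open>f (tab0 \<circ> inv \<sigma>)\<close> depends only on the coset of \<open>\<sigma>\<close>.\<close>

definition \<psi> :: "monomial \<Rightarrow> ((nat \<Rightarrow> nat) \<Rightarrow> complex) \<Rightarrow> monomial \<Rightarrow> complex" where
  "\<psi> \<mu> f \<nu> = (if f \<in> specht la n then
     \<Sum>\<sigma>\<in>perms. f (tab0 \<circ> inv \<sigma>) * (if mon_act \<sigma> \<mu> = \<nu> then mon_sign \<sigma> \<mu> else 0) else 0)"

abbreviation H :: "(((nat \<Rightarrow> nat) \<Rightarrow> complex) \<Rightarrow> monomial \<Rightarrow> complex) set" where
  "H \<equiv> hom_specht la n (component n \<alpha> \<beta>) (comp_rep n \<alpha> \<beta>)"

text \<open>Reindexing the sum by \<open>\<tau> \<circ> \<sigma>\<close> moves \<open>\<tau>\<close>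
  from the tabloid to the monomial, where \<open>mon_sign_comp\<close> splits off its sign.\<close>

lemma \<psi>_tab_rep:
  assumes \<tau>: "\<tau> permutes {0..<n}" and \<mu>: "\<mu> \<in> D" and f: "f \<in> specht la n"
  shows "\<psi> \<mu> (tab_rep \<tau> f) = comp_rep n \<alpha> \<beta> \<tau> (\<psi> \<mu> f)"
proof
  fix \<nu>
  have bij: "bij \<tau>" using \<tau> permutes_bij by blast
  let ?I = "\<lambda>\<sigma> \<nu>. if mon_act \<sigma> \<mu> = \<nu> then mon_sign \<sigma> \<mu> else (0::complex)"
  have step: "tab_rep \<tau> f (tab0 \<circ> inv (\<tau> \<circ> \<sigma>)) * ?I (\<tau> \<circ> \<sigma>) \<nu> = f (tab0 \<circ> inv \<sigma>) *
      (\<Sum>\<kappa>\<in>D. if mon_act \<tau> \<kappa> = \<nu> then mon_sign \<tau> \<kappa> * ?I \<sigma> \<kappa> else 0)" if \<sigma>: "\<sigma> permutes {0..<n}" for \<sigma>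
  proof -
    have "tab0 \<circ> inv (\<tau> \<circ> \<sigma>) \<circ> \<tau> = tab0 \<circ> inv \<sigma>"
      unfolding inv_comp_permutes[OF \<tau> \<sigma>] by (simp add: fun_eq_iff permutes_inverses(2)[OF \<tau>])
    then have "tab_rep \<tau> f (tab0 \<circ> inv (\<tau> \<circ> \<sigma>)) = f (tab0 \<circ> inv \<sigma>)" by (simp add: tab_rep_def)
    moreover have "(\<Sum>\<kappa>\<in>D. if mon_act \<tau> \<kappa> = \<nu> then mon_sign \<tau> \<kappa> * ?I \<sigma> \<kappa> else 0) =
      (\<Sum>\<kappa>\<in>D. if mon_act \<sigma> \<mu> = \<kappa> then (if mon_act \<tau> \<kappa> = \<nu> then mon_sign \<tau> \<kappa> * mon_sign \<sigma> \<mu> else 0) else 0)"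
      by (rule sum.cong) auto
    moreover have "\<dots> = ?I (\<tau> \<circ> \<sigma>) \<nu>"
      using mon_act_in_D[OF \<sigma> \<mu>] finite_D bij permutes_bij[OF \<sigma>] mon_sign_comp[OF \<tau> \<sigma> \<mu>]
      by (simp add: mon_act_comp)
    ultimately show ?thesis by simp
  qed
  have "\<psi> \<mu> (tab_rep \<tau> f) \<nu> = (\<Sum>\<sigma>\<in>perms. tab_rep \<tau> f (tab0 \<circ> inv (\<tau> \<circ> \<sigma>)) * ?I (\<tau> \<circ> \<sigma>) \<nu>)"
    using sum_permutes_left[OF \<tau>, of "\<lambda>\<sigma>. tab_rep \<tau> f (tab0 \<circ> inv \<sigma>) * ?I \<sigma> \<nu>"] specht_tab_rep[OF f \<tau>]
    by (simp add: \<psi>_def)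
  also have "\<dots> = (\<Sum>\<sigma>\<in>perms. \<Sum>\<kappa>\<in>D. f (tab0 \<circ> inv \<sigma>) * (if mon_act \<tau> \<kappa> = \<nu> then mon_sign \<tau> \<kappa> * ?I \<sigma> \<kappa> else 0))"
    by (rule sum.cong) (simp_all add: step sum_distrib_left del: o_apply)
  also have "\<dots> = (\<Sum>\<kappa>\<in>D. \<Sum>\<sigma>\<in>perms. f (tab0 \<circ> inv \<sigma>) * (if mon_act \<tau> \<kappa> = \<nu> then mon_sign \<tau> \<kappa> * ?I \<sigma> \<kappa> else 0))"
    by (rule sum.swap)
  also have "\<dots> = comp_rep n \<alpha> \<beta> \<tau> (\<psi> \<mu> f) \<nu>"
    unfolding comp_rep_def
  proof (rule sum.cong[OF refl])
    fix \<kappa> assume "\<kappa> \<in> D"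
    show "(\<Sum>\<sigma>\<in>perms. f (tab0 \<circ> inv \<sigma>) * (if mon_act \<tau> \<kappa> = \<nu> then mon_sign \<tau> \<kappa> * ?I \<sigma> \<kappa> else 0)) =
      (if mon_act \<tau> \<kappa> = \<nu> then mon_sign \<tau> \<kappa> * \<psi> \<mu> f \<kappa> else 0)"
      using f by (simp add: \<psi>_def sum_distrib_left mult.left_commute)
  qed
  finally show "\<psi> \<mu> (tab_rep \<tau> f) \<nu> = comp_rep n \<alpha> \<beta> \<tau> (\<psi> \<mu> f) \<nu>" .
qed

lemma \<psi>_in_H:
  assumes \<mu>: "\<mu> \<in> D"
  shows "\<psi> \<mu> \<in> H"
  unfolding hom_specht_def mem_Collect_eq
proof (intro conjI allI ballI impI)
  fix f assume "f \<notin> specht la n"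
  then show "\<psi> \<mu> f = 0" by (simp add: \<psi>_def fun_eq_iff)
next
  fix f assume f: "f \<in> specht la n"
  have "\<psi> \<mu> f \<nu> = 0" if "\<nu> \<notin> D" for \<nu>
  proof -
    have "mon_act \<sigma> \<mu> \<noteq> \<nu>" if "\<sigma> \<in> perms" for \<sigma> using mon_act_in_D[OF _ \<mu>] that \<open>\<nu> \<notin> D\<close> by auto
    then show ?thesis by (simp add: \<psi>_def)
  qed
  then show "\<psi> \<mu> f \<in> component n \<alpha> \<beta>" unfolding component_def by blast
next
  fix f g assume "f \<in> specht la n" "g \<in> specht la n"
  then show "\<psi> \<mu> (\<lambda>t. f t + g t) = (\<lambda>v. \<psi> \<mu> f v + \<psi> \<mu> g v)"
    by (simp add: \<psi>_def fun_eq_iff specht_add sum.distrib[symmetric] distrib_right)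
next
  fix c f assume "f \<in> specht la n"
  then show "\<psi> \<mu> (\<lambda>t. c * f t) = (\<lambda>v. c * \<psi> \<mu> f v)"
    by (simp add: \<psi>_def fun_eq_iff specht_scale sum_distrib_left mult.assoc)
next
  fix \<sigma> f assume "\<sigma> permutes {0..<n}" "f \<in> specht la n"
  then show "\<psi> \<mu> (tab_rep \<sigma> f) = comp_rep n \<alpha> \<beta> \<sigma> (\<psi> \<mu> f)" using \<mu> by (intro \<psi>_tab_rep)
qed

text \<open>With \<open>\<sigma> = \<pi> \<circ> \<rho>\<close>, the row permutation \<open>\<rho>\<close> can only decrease \<open>\<Phi>\<close> and the column permutation \<open>\<pi>\<close>
  preserves it. In the case of equality both fix the labelling, so that \<open>\<rho>\<close> moves only even and
  \<open>\<pi>\<close> only odd labels.\<close>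

lemma rearranged_SS:
  assumes \<mu>: "\<mu> \<in> SS" and \<nu>: "\<nu> \<in> SS" and \<sigma>: "\<sigma> permutes {0..<n}" and \<pi>: "\<pi> \<in> C"
    and tab: "tab0 \<circ> inv \<pi> = tab0 \<circ> inv \<sigma>" and act: "mon_act \<sigma> \<mu> = \<nu>"
  shows "\<Phi> \<nu> < \<Phi> \<mu> \<or> \<nu> = \<mu> \<and> of_int (sign \<pi>) * mon_sign \<sigma> \<mu> = 1"
proof (cases "\<Phi> \<nu> < \<Phi> \<mu>")
  case False
  note \<mu>D = SS_D[OF \<mu>] and \<nu>D = SS_D[OF \<nu>] and \<pi>n = permsD[OF \<pi>]
  note \<mu>iff = iffD1[OF SS_iff \<mu>]
  have \<mu>': "\<And>r s. r < n \<Longrightarrow> s < n \<Longrightarrow> row s = row r \<Longrightarrow> col s = Suc (col r) \<Longrightarrow> rk \<mu> r \<le> rk \<mu> s"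
    "\<And>r s. r < n \<Longrightarrow> s < n \<Longrightarrow> col s = col r \<Longrightarrow> row s = Suc (row r) \<Longrightarrow> rk \<mu> r \<le> rk \<mu> s"
    "\<And>r s. r < n \<Longrightarrow> s < n \<Longrightarrow> r \<noteq> s \<Longrightarrow> rk \<mu> r = rk \<mu> s \<Longrightarrow> r \<notin> odd_rows \<mu> \<Longrightarrow> col r \<noteq> col s"
    "\<And>r s. r < n \<Longrightarrow> s < n \<Longrightarrow> r \<noteq> s \<Longrightarrow> rk \<mu> r = rk \<mu> s \<Longrightarrow> r \<in> odd_rows \<mu> \<Longrightarrow> row r \<noteq> row s"
    using \<mu>iff[THEN conjunct2, THEN conjunct1] \<mu>iff[THEN conjunct2, THEN conjunct2, THEN conjunct1]
      \<mu>iff[THEN conjunct2, THEN conjunct2, THEN conjunct2, THEN conjunct1]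
      \<mu>iff[THEN conjunct2, THEN conjunct2, THEN conjunct2, THEN conjunct2]
    by simp_all
  have \<nu>': "\<And>r s. r < n \<Longrightarrow> s < n \<Longrightarrow> col s = col r \<Longrightarrow> row s = Suc (row r) \<Longrightarrow> rk \<nu> r \<le> rk \<nu> s"
    using iffD1[OF SS_iff \<nu>, THEN conjunct2, THEN conjunct2, THEN conjunct1] by simp
  define f where "f = rk \<mu>"
  have \<Phi>\<mu>: "\<Phi> \<mu> = (\<Sum>k\<in>{0..<n}. col k * f k)" and \<Psi>\<mu>: "\<Psi> \<mu> = (\<Sum>k\<in>{0..<n}. row k * f k)"
    by (simp_all add: \<Phi>_def \<Psi>_def f_def)
  define \<rho> where "\<rho> = inv \<pi> \<circ> \<sigma>"
  have \<rho>n: "\<rho> permutes {0..<n}" unfolding \<rho>_def using \<sigma> permutes_inv[OF \<pi>n] by (rule permutes_compose)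
  have \<sigma>eq: "\<sigma> = \<pi> \<circ> \<rho>" by (simp add: \<rho>_def fun_eq_iff permutes_inverses(1)[OF \<pi>n])
  \<comment> \<open>Equality of the two tabloids says exactly that
    \<open>inv \<pi> \<circ> \<sigma>\<close> preserves the rows of \<open>t0\<close>.\<close>
  have row\<rho>: "row (\<rho> k) = row k" if "k < n" for k
  proof -
    have "tab0 (inv \<pi> (\<sigma> k)) = tab0 (inv \<sigma> (\<sigma> k))" using tab by (metis comp_apply)
    then show ?thesis using that perm_less[OF \<rho>n, of k] permutes_inverses(2)[OF \<sigma>]
      by (simp add: tab0_def \<rho>_def)
  qed
  have row\<rho>': "row (inv \<rho> k) = row k" if "k < n" for k
    using row\<rho>[of "inv \<rho> k"] perm_less[OF permutes_inv[OF \<rho>n]] permutes_inverses(1)[OF \<rho>n] that by simp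
  have col\<pi>: "col (\<pi> k) = col k" "col (inv \<pi> k) = col k" if "k < n" for k
    using \<pi> C_inv[OF \<pi>] that by (auto simp: C_def)
  have rk\<nu>: "rk \<nu> k = f (inv \<rho> (inv \<pi> k))" for k
    using rk_act(1)[OF \<sigma>, of \<mu> k] act inv_comp_permutes[OF \<pi>n \<rho>n] by (simp add: f_def \<sigma>eq)
  have "\<Phi> \<nu> = (\<Sum>k\<in>{0..<n}. col (inv \<pi> k) * f (inv \<rho> (inv \<pi> k)))"
    unfolding \<Phi>_def by (rule sum.cong) (simp_all add: rk\<nu> col\<pi>)
  also have "\<dots> = (\<Sum>k\<in>{0..<n}. col k * f (inv \<rho> k))"
    using sum.permute[OF permutes_inv[OF \<pi>n], of "\<lambda>k. col k * f (inv \<rho> k)"] by (simp add: o_def)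
  finally have \<Phi>\<nu>: "\<Phi> \<nu> = (\<Sum>k\<in>{0..<n}. col k * f (inv \<rho> k))" .
  have "f r \<le> f s" if "r < n" "s < n" "row s = row r" "col r \<le> col s" for r s
    unfolding f_def by (rule row_mono[of "rk \<mu>", OF \<mu>'(1) that])
  then have "\<Phi> \<nu> \<le> \<Phi> \<mu> \<and> (\<Phi> \<nu> = \<Phi> \<mu> \<longrightarrow> (\<exists>\<kappa>. \<kappa> permutes {0..<n} \<and>
      (\<forall>r\<in>{0..<n}. row (\<kappa> r) = row r \<and> col (\<kappa> r) = col r \<and> f (inv \<rho> (\<kappa> r)) = f r)))"
    unfolding \<Phi>\<nu> \<Phi>\<mu>
    by (intro rearrangement) (simp_all add: permutes_inv[OF \<rho>n] row\<rho>')
  then obtain \<kappa> where \<kappa>: "\<kappa> permutes {0..<n}"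
    "\<And>r. r < n \<Longrightarrow> row (\<kappa> r) = row r \<and> col (\<kappa> r) = col r \<and> f (inv \<rho> (\<kappa> r)) = f r"
    using False by auto
  \<comment> \<open>\<open>\<kappa>\<close> preserves both row and column of each entry, so it is
    the identity.\<close>
  have f\<rho>': "f (inv \<rho> k) = f k" if "k < n" for k
    using \<kappa>(2)[OF that] row_col_inj[of "\<kappa> k" k] perm_less[OF \<kappa>(1)] that by simp
  have f\<rho>: "f (\<rho> k) = f k" if "k < n" for k
    using f\<rho>'[of "\<rho> k"] perm_less[OF \<rho>n] permutes_inverses(2)[OF \<rho>n] that by simp
  have rk\<nu>': "rk \<nu> k = f (inv \<pi> k)" if "k < n" for k
    using rk\<nu> f\<rho>' perm_less[OF permutes_inv[OF \<pi>n]] that by simp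
  have rk\<mu>': "f k = rk \<nu> (\<pi> k)" if "k < n" for k
    using rk\<nu>' perm_less[OF \<pi>n] permutes_inverses(2)[OF \<pi>n] that by simp
  have "f r \<le> f s" if "r < n" "s < n" "col s = col r" "row r \<le> row s" for r s
    unfolding f_def by (rule col_mono[of "rk \<mu>", OF \<mu>'(2) that])
  \<comment> \<open>The labellings of \<open>\<mu>\<close> and \<open>\<nu>\<close> now differ by
    \<open>\<pi>\<close> within columns, and both increase down the columns. Applying the inequality
    in both directions gives \<open>\<Psi> \<mu> = \<Psi> \<nu>\<close>, hence the equality
    case.\<close>
  then have R\<mu>: "(\<Sum>k\<in>{0..<n}. row k * f (inv \<pi> k)) \<le> \<Psi> \<mu> \<and>
      ((\<Sum>k\<in>{0..<n}. row k * f (inv \<pi> k)) = \<Psi> \<mu> \<longrightarrow> (\<exists>\<kappa>. \<kappa> permutes {0..<n} \<and>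
      (\<forall>r\<in>{0..<n}. col (\<kappa> r) = col r \<and> row (\<kappa> r) = row r \<and> f (inv \<pi> (\<kappa> r)) = f r)))"
    unfolding \<Psi>\<mu>
    by (intro rearrangement) (simp_all add: permutes_inv[OF \<pi>n] col\<pi>)
  have "rk \<nu> r \<le> rk \<nu> s" if "r < n" "s < n" "col s = col r" "row r \<le> row s" for r s
    by (rule col_mono[of "rk \<nu>", OF \<nu>' that])
  then have "(\<Sum>k\<in>{0..<n}. row k * rk \<nu> (\<pi> k)) \<le> \<Psi> \<nu> \<and>
      ((\<Sum>k\<in>{0..<n}. row k * rk \<nu> (\<pi> k)) = \<Psi> \<nu> \<longrightarrow> (\<exists>\<kappa>. \<kappa> permutes {0..<n} \<and>
      (\<forall>r\<in>{0..<n}. col (\<kappa> r) = col r \<and> row (\<kappa> r) = row r \<and> rk \<nu> (\<pi> (\<kappa> r)) = rk \<nu> r)))"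
    unfolding \<Psi>_def by (intro rearrangement) (simp_all add: \<pi>n col\<pi>)
  moreover have "(\<Sum>k\<in>{0..<n}. row k * rk \<nu> (\<pi> k)) = \<Psi> \<mu>" "(\<Sum>k\<in>{0..<n}. row k * f (inv \<pi> k)) = \<Psi> \<nu>"
    unfolding \<Psi>\<mu> unfolding \<Psi>_def by (simp_all add: rk\<nu>' rk\<mu>')
  ultimately have "\<Psi> \<mu> \<le> \<Psi> \<nu>" "\<Psi> \<nu> \<le> \<Psi> \<mu>" and
    "\<Psi> \<nu> = \<Psi> \<mu> \<longrightarrow> (\<exists>\<kappa>. \<kappa> permutes {0..<n} \<and>
      (\<forall>r\<in>{0..<n}. col (\<kappa> r) = col r \<and> row (\<kappa> r) = row r \<and> f (inv \<pi> (\<kappa> r)) = f r))"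
    using R\<mu> by simp_all
  then obtain \<kappa>' where \<kappa>': "\<kappa>' permutes {0..<n}"
    "\<And>r. r < n \<Longrightarrow> row (\<kappa>' r) = row r \<and> col (\<kappa>' r) = col r \<and> f (inv \<pi> (\<kappa>' r)) = f r"
    by auto
  have f\<pi>': "f (inv \<pi> k) = f k" if "k < n" for k
    using \<kappa>'(2)[OF that] row_col_inj[of "\<kappa>' k" k] perm_less[OF \<kappa>'(1)] that by simp
  have f\<pi>: "f (\<pi> k) = f k" if "k < n" for k
    using f\<pi>'[of "\<pi> k"] perm_less[OF \<pi>n] permutes_inverses(2)[OF \<pi>n] that by simp
  have "\<nu> = \<mu>"
    using \<nu>D \<mu>D by (rule monomial_eqI) (use rk\<nu>' f\<pi>' in \<open>simp add: f_def\<close>)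
  \<comment> \<open>A moved odd entry would meet an equal odd label in its own row, against
    condition (4); dually, condition (3) keeps \<open>\<pi>\<close> from moving even
    entries.\<close>
  moreover have "mon_sign \<rho> \<mu> = 1"
  proof (rule mon_sign_fixed[OF \<rho>n \<mu>D], rule ccontr)
    fix k assume k: "k \<in> odd_rows \<mu>" "\<rho> k \<noteq> k"
    then have "k < n" by (simp add: odd_rows_def)
    then show False using \<mu>'(4)[of k "\<rho> k"] k f\<rho>[of k] row\<rho>[of k] perm_less[OF \<rho>n] by (auto simp: f_def)
  qed
  moreover have "\<pi> permutes (odd_rows \<mu>)"
  proof (rule permutes_superset[OF \<pi>n])
    fix k assume "k \<in> {0..<n} - odd_rows \<mu>"
    then show "\<pi> k = k" using \<mu>'(3)[of k "\<pi> k"] f\<pi>[of k] col\<pi>[of k] perm_less[OF \<pi>n, of k] by (cases "k = \<pi> k") (auto simp: f_def)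
  qed
  then have "mon_sign \<pi> \<mu> = of_int (sign \<pi>)" by (rule mon_sign_permutes[OF \<pi>n \<mu>D]) simp
  moreover have "mon_act \<rho> \<mu> = \<mu>"
    by (rule mon_act_eq_self(2)[OF \<rho>n \<mu>D]) (use f\<rho> in \<open>simp add: f_def\<close>)
  ultimately show ?thesis
    using mon_sign_comp[OF \<pi>n \<rho>n \<mu>D] by (simp add: \<sigma>eq of_int_mult[symmetric] del: of_int_mult)
qed simp

text \<open>Expanding \<open>e\<close> turns the coefficient into a sum over pairs to each of which
  \<open>rearranged_SS\<close> applies.\<close>

lemma \<psi>_e:
  "\<psi> \<mu> e \<nu> = (\<Sum>(\<sigma>, \<pi>)\<in>{(\<sigma>, \<pi>). \<sigma> \<in> perms \<and> \<pi> \<in> C \<and> tab0 \<circ> inv \<pi> = tab0 \<circ> inv \<sigma> \<and> mon_act \<sigma> \<mu> = \<nu>}.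
    of_int (sign \<pi>) * mon_sign \<sigma> \<mu>)"
proof -
  let ?Q = "\<lambda>x. tab0 \<circ> inv (snd x) = tab0 \<circ> inv (fst x) \<and> mon_act (fst x) \<mu> = \<nu>"
  have "\<psi> \<mu> e \<nu> = (\<Sum>\<sigma>\<in>perms. \<Sum>\<pi>\<in>C. if ?Q (\<sigma>, \<pi>) then of_int (sign \<pi>) * mon_sign \<sigma> \<mu> else 0)"
    using e_in unfolding \<psi>_def e_def sum_distrib_right by (auto intro!: sum.cong)
  also have "\<dots> = (\<Sum>x\<in>perms \<times> C. if ?Q x then of_int (sign (snd x)) * mon_sign (fst x) \<mu> else 0)"
    by (simp add: sum.cartesian_product case_prod_beta)
  also have "\<dots> = (\<Sum>x\<in>{x \<in> perms \<times> C. ?Q x}. of_int (sign (snd x)) * mon_sign (fst x) \<mu>)"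
    by (rule sum.inter_filter[symmetric]) (intro finite_cartesian_product finite_perms finite_C)
  also have "{x \<in> perms \<times> C. ?Q x} = {(\<sigma>, \<pi>). \<sigma> \<in> perms \<and> \<pi> \<in> C \<and> tab0 \<circ> inv \<pi> = tab0 \<circ> inv \<sigma> \<and> mon_act \<sigma> \<mu> = \<nu>}"
    by auto
  finally show ?thesis by (simp add: case_prod_beta)
qed

lemma \<psi>_e_triangular:
  assumes "\<nu> \<in> SS" "\<mu> \<in> SS" "\<nu> \<noteq> \<mu>" "\<not> \<Phi> \<nu> < \<Phi> \<mu>"
  shows "\<psi> \<mu> e \<nu> = 0"
proof -
  have "{(\<sigma>, \<pi>). \<sigma> \<in> perms \<and> \<pi> \<in> C \<and> tab0 \<circ> inv \<pi> = tab0 \<circ> inv \<sigma> \<and> mon_act \<sigma> \<mu> = \<nu>} = {}"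
    using rearranged_SS[OF assms(2,1)] assms(3,4) by auto
  then show ?thesis unfolding \<psi>_e by (simp only: sum.empty)
qed

text \<open>By \<open>rearranged_SS\<close> every term equals 1, so the coefficient is the number of
  admissible pairs, and \<open>(id, id)\<close> is one of them.\<close>

lemma \<psi>_e_diagonal:
  assumes "\<mu> \<in> SS"
  shows "\<psi> \<mu> e \<mu> \<noteq> 0"
proof -
  let ?S = "{(\<sigma>, \<pi>). \<sigma> \<in> perms \<and> \<pi> \<in> C \<and> tab0 \<circ> inv \<pi> = tab0 \<circ> inv \<sigma> \<and> mon_act \<sigma> \<mu> = \<mu>}"
  have fin: "finite ?S"
    by (rule finite_subset[of _ "perms \<times> C"]) (auto simp: finite_C finite_perms)
  have "\<psi> \<mu> e \<mu> = (\<Sum>x\<in>?S. 1)"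
    unfolding \<psi>_e by (rule sum.cong) (use rearranged_SS[OF assms assms] in auto)
  moreover have "(id, id) \<in> ?S" by (simp add: C_def permutes_id mon_act_id)
  then have "card ?S \<noteq> 0" using fin card_0_eq by blast
  ultimately show ?thesis by simp
qed

section \<open>The space of homomorphisms and its dimension\<close>

lemma HD:
  assumes "\<phi> \<in> H"
  shows "f \<notin> specht la n \<Longrightarrow> \<phi> f = 0"
    and "f \<in> specht la n \<Longrightarrow> \<phi> f \<in> component n \<alpha> \<beta>"
    and "f \<in> specht la n \<Longrightarrow> g \<in> specht la n \<Longrightarrow> \<phi> (\<lambda>t. f t + g t) = (\<lambda>v. \<phi> f v + \<phi> g v)"
    and "f \<in> specht la n \<Longrightarrow> \<phi> (\<lambda>t. c * f t) = (\<lambda>v. c * \<phi> f v)"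
    and "f \<in> specht la n \<Longrightarrow> \<sigma> permutes {0..<n} \<Longrightarrow> \<phi> (tab_rep \<sigma> f) = comp_rep n \<alpha> \<beta> \<sigma> (\<phi> f)"
  using assms unfolding hom_specht_def by blast+

lemma H_zero: "\<phi> \<in> H \<Longrightarrow> \<phi> (\<lambda>t. 0) = (\<lambda>v. 0)"
  using HD(4)[of \<phi> e 0] e_in by simp

lemma H_sum:
  assumes \<phi>: "\<phi> \<in> H" and f: "\<And>i. i \<in> I \<Longrightarrow> f i \<in> specht la n"
  shows "\<phi> (\<lambda>t. \<Sum>i\<in>I. c i * f i t) = (\<lambda>v. \<Sum>i\<in>I. c i * \<phi> (f i) v)"
  using f
proof (induction I rule: infinite_finite_induct)
  case (insert x F)
  have "\<phi> (\<lambda>t. c x * f x t + (\<Sum>i\<in>F. c i * f i t)) = (\<lambda>v. c x * \<phi> (f x) v + (\<Sum>i\<in>F. c i * \<phi> (f i) v))"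
    using HD(3)[OF \<phi>, of "\<lambda>t. c x * f x t" "\<lambda>t. \<Sum>i\<in>F. c i * f i t"] HD(4)[OF \<phi>, of "f x" "c x"] insert
    by (simp add: specht_sum specht_scale)
  then show ?case using insert by simp
qed (simp_all add: H_zero[OF \<phi>])

lemma H_add: "\<phi> \<in> H \<Longrightarrow> \<chi> \<in> H \<Longrightarrow> (\<lambda>f v. \<phi> f v + \<chi> f v) \<in> H"
  and H_scale: "\<phi> \<in> H \<Longrightarrow> (\<lambda>f v. c * \<phi> f v) \<in> H"
  unfolding hom_specht_def mem_Collect_eq component_def
  by (auto simp: comp_rep_apply distrib_left fun_eq_iff)

text \<open>The relations satisfied by \<open>e\<close> carry over to \<open>\<phi> e\<close>, which
  therefore vanishes; since \<open>e\<close> generates the Specht module, so does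
  \<open>\<phi>\<close>.\<close>

lemma H_eq_zero:
  assumes \<phi>: "\<phi> \<in> H" and SS: "\<And>\<mu>. \<mu> \<in> SS \<Longrightarrow> \<phi> e \<mu> = 0"
  shows "\<phi> f \<nu> = 0"
proof -
  interpret garnir_vector n \<alpha> \<beta> la t0 "\<phi> e"
  proof unfold_locales
    show "\<phi> e \<nu> = 0" if "\<nu> \<notin> D" for \<nu>
      using HD(2)[OF \<phi> e_in] that unfolding component_def by blast
    show "comp_rep n \<alpha> \<beta> \<pi> (\<phi> e) \<nu> = of_int (sign \<pi>) * \<phi> e \<nu>" if "\<pi> \<in> C" for \<pi> \<nu>
    proof -
      have "comp_rep n \<alpha> \<beta> \<pi> (\<phi> e) = (\<lambda>v. of_int (sign \<pi>) * \<phi> e v)"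
        unfolding HD(5)[OF \<phi> e_in permsD[OF that], symmetric] tab_rep_C[OF that] by (rule HD(4)[OF \<phi> e_in])
      then show ?thesis by simp
    qed
    show "(\<Sum>\<sigma> | \<sigma> permutes garnir i j. of_int (sign \<sigma>) * comp_rep n \<alpha> \<beta> \<sigma> (\<phi> e) \<nu>) = 0"
      if "(i, Suc j) \<in> young_cells la" for i j \<nu>
    proof -
      have perm: "\<sigma> permutes {0..<n}" if "\<sigma> permutes garnir i j" for \<sigma>
        using that by (rule permutes_subset) (auto simp: garnir_def)
      have "\<phi> (\<lambda>t. \<Sum>\<sigma> | \<sigma> permutes garnir i j. of_int (sign \<sigma>) * tab_rep \<sigma> e t) \<nu> =
          (\<Sum>\<sigma> | \<sigma> permutes garnir i j. of_int (sign \<sigma>) * \<phi> (tab_rep \<sigma> e) \<nu>)"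
        using H_sum[OF \<phi>, of "{\<sigma>. \<sigma> permutes garnir i j}" "\<lambda>\<sigma>. tab_rep \<sigma> e" "\<lambda>\<sigma>. of_int (sign \<sigma>)"]
          tab_rep_e_in perm by simp
      also have "\<dots> = (\<Sum>\<sigma> | \<sigma> permutes garnir i j. of_int (sign \<sigma>) * comp_rep n \<alpha> \<beta> \<sigma> (\<phi> e) \<nu>)"
        by (rule sum.cong) (simp_all add: HD(5)[OF \<phi> e_in] perm)
      finally show ?thesis using H_zero[OF \<phi>] by (simp add: garnir_relation[OF that])
    qed
  qed
  have e0: "\<phi> e = (\<lambda>v. 0)" using zero_if_zero_on_SS SS by auto
  show ?thesis
  proof (cases "f \<in> specht la n")
    case True
    then obtain c where f: "f = (\<lambda>t. \<Sum>\<sigma>\<in>perms. c \<sigma> * tab_rep \<sigma> e t)" by (elim spechtE)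
    have "\<phi> f \<nu> = (\<Sum>\<sigma>\<in>perms. c \<sigma> * \<phi> (tab_rep \<sigma> e) \<nu>)"
      using H_sum[OF \<phi>, of perms "\<lambda>\<sigma>. tab_rep \<sigma> e" c] tab_rep_e_in by (simp add: f)
    also have "\<dots> = 0"
      by (rule sum.neutral) (auto simp: HD(5)[OF \<phi> e_in] e0 comp_rep_apply)
    finally show ?thesis .
  qed (simp add: HD(1)[OF \<phi>])
qed

lemma vector_space_fun: "vector_space (\<lambda>(c::complex) \<phi>. (\<lambda>f v. c * \<phi> f v))"
  by unfold_locales (auto simp: fun_eq_iff algebra_simps)

lemma sum_scale_apply:
  "(\<Sum>i\<in>I. (\<lambda>f v. c i * \<phi> i f v)) = (\<lambda>f v. \<Sum>i\<in>I. c i * (\<phi> i f v :: complex))"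
  by (induction I rule: infinite_finite_induct) (auto simp: fun_eq_iff)

lemma finite_SS: "finite SS"
  using finite_D by (simp add: SS_def)

lemma multiplicity_eq_card_SS: "multiplicity la n (component n \<alpha> \<beta>) (comp_rep n \<alpha> \<beta>) = card SS"
proof -
  interpret vector_space "\<lambda>(c::complex) (\<phi> :: ((nat \<Rightarrow> nat) \<Rightarrow> complex) \<Rightarrow> monomial \<Rightarrow> complex). (\<lambda>f v. c * \<phi> f v)"
    by (rule vector_space_fun)
  \<comment> \<open>If two distinct indices gave the same map, both off-diagonal coefficients would
    be nonzero, forcing \<open>\<Phi>\<close> to be strictly smaller in each direction.\<close>
  have inj: "inj_on \<psi> SS"
    using \<psi>_e_triangular \<psi>_e_diagonal by (intro inj_onI) (metis less_asym)
  have comb: "(\<lambda>f v. \<Sum>\<mu>\<in>I. c \<mu> * \<psi> \<mu> f v) \<in> H" if "I \<subseteq> SS" "finite I" for c I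
    using that(2,1)
  proof (induction I)
    case empty
    show ?case by (auto simp: hom_specht_def component_def comp_rep_apply fun_eq_iff)
  next
    case (insert \<mu> I)
    then show ?case using H_add[OF H_scale[OF \<psi>_in_H[of \<mu>]]] SS_D by simp
  qed
  have "dim H = card SS"
  proof (rule dim_unique)
    show "\<psi> ` SS \<subseteq> H" using \<psi>_in_H SS_D by auto
    show "card (\<psi> ` SS) = card SS" by (rule card_image[OF inj])
    show "independent (\<psi> ` SS)"
    proof
      assume "dependent (\<psi> ` SS)"
      then obtain c where "\<exists>\<phi>\<in>\<psi> ` SS. c \<phi> \<noteq> 0" and zero: "(\<Sum>\<phi>\<in>\<psi> ` SS. (\<lambda>f v. c \<phi> * \<phi> f v)) = 0"
        unfolding dependent_finite[OF finite_imageI[OF finite_SS]] by (elim exE conjE) (rule that)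
      then obtain \<mu> where \<mu>: "\<mu> \<in> SS" "c (\<psi> \<mu>) \<noteq> 0" by (elim bexE imageE) simp
      have comb0: "(\<Sum>\<mu>\<in>SS. c (\<psi> \<mu>) * \<psi> \<mu> e \<nu>) = 0" for \<nu>
      proof -
        have "(\<lambda>f v. \<Sum>\<mu>\<in>SS. c (\<psi> \<mu>) * \<psi> \<mu> f v) = 0"
          using zero by (simp add: sum_scale_apply sum.reindex[OF inj])
        from fun_cong[OF fun_cong[OF this, of e], of \<nu>] show ?thesis by simp
      qed
      have "c (\<psi> \<mu>) = 0"
      proof (rule triangular_unique[where M = "\<lambda>\<nu> \<mu>. \<psi> \<mu> e \<nu>" and F = \<Phi> and c = "\<lambda>\<mu>. c (\<psi> \<mu>)" and I = SS])
        show "(\<Sum>\<mu>\<in>SS. c (\<psi> \<mu>) * \<psi> \<mu> e \<nu>) = 0" for \<nu> by (rule comb0)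
      qed (use \<psi>_e_triangular \<psi>_e_diagonal finite_SS \<mu>(1) in blast)+
      with \<mu>(2) show False by (rule notE)
    qed
    show "H \<subseteq> span (\<psi> ` SS)"
    proof
      fix \<phi> assume \<phi>: "\<phi> \<in> H"
      have "\<exists>c. \<forall>\<nu>\<in>SS. (\<Sum>\<mu>\<in>SS. c \<mu> * \<psi> \<mu> e \<nu>) = \<phi> e \<nu>"
        using \<psi>_e_triangular \<psi>_e_diagonal finite_SS
        by (intro triangular_solve[where M = "\<lambda>\<nu> \<mu>. \<psi> \<mu> e \<nu>" and F = \<Phi> and I = SS])
      then obtain c where c: "\<And>\<nu>. \<nu> \<in> SS \<Longrightarrow> (\<Sum>\<mu>\<in>SS. c \<mu> * \<psi> \<mu> e \<nu>) = \<phi> e \<nu>" by blast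
      \<comment> \<open>The difference vanishes at \<open>e\<close> on all of \<open>SS\<close>,
        hence vanishes by \<open>H_eq_zero\<close>.\<close>
      have "(\<lambda>f v. \<phi> f v + (-1) * (\<Sum>\<mu>\<in>SS. c \<mu> * \<psi> \<mu> f v)) \<in> H"
        by (rule H_add[OF \<phi> H_scale[OF comb[OF subset_refl finite_SS]]])
      from H_eq_zero[OF this] c have "\<phi> f v = (\<Sum>\<mu>\<in>SS. c \<mu> * \<psi> \<mu> f v)" for f v by simp
      then have "\<phi> = (\<Sum>\<mu>\<in>SS. (\<lambda>f v. c \<mu> * \<psi> \<mu> f v))" by (simp add: sum_scale_apply fun_eq_iff)
      also have "\<dots> \<in> span (\<psi> ` SS)"
        by (rule span_sum) (rule span_scale[OF span_base], simp)
      finally show "\<phi> \<in> span (\<psi> ` SS)" .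
    qed
  qed
  then show ?thesis by (simp add: multiplicity_def)
qed

section \<open>Monomials as multiset tableaux\<close>

lemma count_sum_mset: "count (\<Sum>x\<in>A. f x) y = (\<Sum>x\<in>A. count (f x) y)"
  by (induction A rule: infinite_finite_induct) auto

text \<open>The degree of a monomial is the content of its filling, counted letter by letter;
  conversely, exponents and theta's are read off as multiplicities of letters.\<close>

lemma bij_filling: "bij_betw filling SS (multiset_tableaux la (target_content \<alpha> \<beta>))"
proof (rule bij_betw_imageI)
  show "inj_on filling SS"
  proof (rule inj_onI)
    fix \<mu> \<nu> assume *: "\<mu> \<in> SS" "\<nu> \<in> SS" "filling \<mu> = filling \<nu>"
    have "lab \<mu> r = lab \<nu> r" if "r < n" for r
      using fun_cong[OF *(3), of "pos r"] pos_in[OF that] t0_pos[OF that] by (simp add: filling_def)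
    then show "\<mu> = \<nu>" using * SS_D lab_inj by blast
  qed
  have target: "count (target_content \<alpha> \<beta>) (False, k) = (if k < length \<alpha> then \<alpha> ! k else 0)"
    "count (target_content \<alpha> \<beta>) (True, k) = (if k < length \<beta> then \<beta> ! k else 0)" for k
    by (simp_all add: target_content_def count_sum_replicate)
  have reindex: "(\<Sum>c\<in>young_cells la. F c) = (\<Sum>r<n. F (pos r))" for F :: "_ \<Rightarrow> nat"
    by (rule sum.reindex_bij_witness[of _ pos t0]) (auto simp: pos_in t0_less pos_t0 t0_pos)
  have card: "card {r. (r, i) \<in> S} = (\<Sum>r<n. if (r, i) \<in> S then 1 else 0)" if "S \<subseteq> {0..<n} \<times> B" for S i and B :: "nat set"
  proof -
    have "{r. (r, i) \<in> S} = {r \<in> {..<n}. (r, i) \<in> S}" using that by auto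
    then show ?thesis by (simp add: sum.If_cases Int_def)
  qed
  show "filling ` SS = multiset_tableaux la (target_content \<alpha> \<beta>)"
  proof (intro equalityI subsetI)
    fix T assume "T \<in> filling ` SS"
    then obtain \<mu> where \<mu>: "\<mu> \<in> SS" "T = filling \<mu>" by auto
    note \<mu>D = SS_D[OF \<mu>(1)]
    have "count (tableau_content la T) x = count (target_content \<alpha> \<beta>) x" for x
    proof -
      have "count (tableau_content la T) x = (\<Sum>r<n. count (lab \<mu> r) x)"
        unfolding tableau_content_def count_sum_mset reindex
        by (rule sum.cong) (simp_all add: \<mu>(2) filling_def pos_in t0_pos)
      also have "\<dots> = count (target_content \<alpha> \<beta>) x"
      proof (cases x)
        case (Pair b k)
        obtain a S where aS: "\<mu> = (a, S)" by (cases \<mu>)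
        have S: "S \<subseteq> {0..<n} \<times> {0..<length \<beta>}" using \<mu>D aS by (simp add: deg_monomials_def)
        show ?thesis
        proof (cases b)
          case True
          have "card {r. (r, k) \<in> S} = (if k < length \<beta> then \<beta> ! k else 0)"
          proof (cases "k < length \<beta>")
            case False
            then have "{r. (r, k) \<in> S} = {}" using S by auto
            then show ?thesis using False by simp
          qed (use \<mu>D aS in \<open>simp add: deg_monomials_def\<close>)
          then show ?thesis
            using True Pair card[OF S, of k] by (simp add: count_row_label[OF finite_snd[OF \<mu>D, unfolded aS]] target aS)
        next
          case False
          then show ?thesis using \<mu>D Pair aS
            by (simp add: count_row_label[OF finite_snd[OF \<mu>D, unfolded aS]] target deg_monomials_def)
        qed
      qed
      finally show ?thesis .
    qed
    then have "tableau_content la T = target_content \<alpha> \<beta>" by (rule multiset_eqI)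
    then show "T \<in> multiset_tableaux la (target_content \<alpha> \<beta>)"
      using \<mu> by (auto simp: multiset_tableaux_def SS_def filling_def)
  next
    fix T assume "T \<in> multiset_tableaux la (target_content \<alpha> \<beta>)"
    then have T: "is_multiset_tableau la T" "\<And>c. c \<notin> young_cells la \<Longrightarrow> T c = {#}"
      "tableau_content la T = target_content \<alpha> \<beta>" by (auto simp: multiset_tableaux_def)
    have cont: "(\<Sum>r<n. count (T (pos r)) x) = count (target_content \<alpha> \<beta>) x" for x
      unfolding T(3)[symmetric] tableau_content_def count_sum_mset reindex ..
    \<comment> \<open>The letter type is infinite; bounding each label by the content keeps it
      inside the alphabet of the given degrees.\<close>
    have le: "count (T (pos r)) x \<le> count (target_content \<alpha> \<beta>) x" if "r < n" for r x
      unfolding cont[symmetric] using that by (intro member_le_sum) auto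
    have le1: "count (T (pos r)) (True, i) \<le> 1" if "r < n" for r i
      using T(1) pos_in[OF that] by (auto simp: is_multiset_tableau_def)
    define a where "a r k = (if r < n then count (T (pos r)) (False, k) else 0)" for r k
    define S where "S = {(r, i). r < n \<and> (True, i) \<in># T (pos r)}"
    \<comment> \<open>By condition (1) a barred letter has multiplicity 0 or 1, so the set
      \<open>S\<close> loses nothing.\<close>
    have count1: "count (T (pos r)) (True, i) = (if (r, i) \<in> S then 1 else 0)" if "r < n" for r i
    proof (cases "(True, i) \<in># T (pos r)")
      case True
      then have "0 < count (T (pos r)) (True, i)" by (rule count_greater_zero_iff[THEN iffD2])
      then have "count (T (pos r)) (True, i) = 1" using le1[OF that, of i] by linarith
      then show ?thesis using that True by (simp add: S_def)
    qed (use that in \<open>simp add: S_def not_in_iff\<close>)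
    have S: "S \<subseteq> {0..<n} \<times> {0..<length \<beta>}"
    proof
      fix x assume "x \<in> S"
      then obtain r i where x: "x = (r, i)" "r < n" "(True, i) \<in># T (pos r)" by (auto simp: S_def)
      then have "0 < count (T (pos r)) (True, i)" by simp
      then have "0 < count (target_content \<alpha> \<beta>) (True, i)" using le[OF x(2), of "(True, i)"] by linarith
      then show "x \<in> {0..<n} \<times> {0..<length \<beta>}" using x by (simp add: target split: if_splits)
    qed
    have azero: "a r k = 0" if "n \<le> r \<or> length \<alpha> \<le> k" for r k
      using le[of r "(False, k)"] that by (auto simp: a_def target)
    have D: "(a, S) \<in> D"
      unfolding deg_monomials_def mem_Collect_eq case_prod_conv
    proof (intro conjI allI impI)
      fix r k assume "n \<le> r \<or> length \<alpha> \<le> k" then show "a r k = 0" by (rule azero)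
    next
      fix k assume "k < length \<alpha>"
      then show "(\<Sum>r<n. a r k) = \<alpha> ! k" using cont[of "(False, k)"] by (simp add: a_def target)
    next
      show "S \<subseteq> {0..<n} \<times> {0..<length \<beta>}" by (rule S)
    next
      fix i assume "i < length \<beta>"
      then show "card {r. (r, i) \<in> S} = \<beta> ! i"
        using cont[of "(True, i)"] card[OF S, of i] by (simp add: target count1)
    qed
    have lab: "lab (a, S) r = T (pos r)" if "r < n" for r
    proof (rule multiset_eqI)
      fix x :: letter
      show "count (lab (a, S) r) x = count (T (pos r)) x"
      proof (cases x)
        case (Pair b k)
        then show ?thesis
          using that azero[of r k] count1[OF that, of k] count_row_label[OF finite_snd[OF D], of "length \<alpha>" r k]
          by (cases b) (auto simp: a_def)
      qed
    qed
    have "filling (a, S) c = T c" for c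
      using T(2) lab t0_less pos_t0 by (simp add: filling_def)
    then have "filling (a, S) = T" by (rule ext)
    then show "T \<in> filling ` SS" using D T(1) by (force simp: SS_def)
  qed
qed

end

lemma ex_tableau:
  assumes "is_partition n la"
  shows "\<exists>t0. t0 \<in> tableaux la n"
proof -
  have cells: "young_cells la = (SIGMA i:{..<length la}. {..<la ! i})"
    by (auto simp: young_cells_def)
  have "card (young_cells la) = n"
    using assms by (simp add: cells is_partition_def sum_list_sum_nth atLeast0LessThan)
  moreover have "finite (young_cells la)" by (simp add: cells)
  ultimately obtain f where f: "bij_betw f (young_cells la) {0..<n}"
    using finite_same_card_bij[of "young_cells la" "{0..<n}"] by auto
  have "bij_betw (\<lambda>c. if c \<in> young_cells la then f c else 0) (young_cells la) {0..<n}"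
    by (rule bij_betw_cong[THEN iffD1, OF _ f]) simp
  then show ?thesis by (auto simp: tableaux_def intro!: exI[of _ "\<lambda>c. if c \<in> young_cells la then f c else 0"])
qed

theorem theorem3p1:
  fixes n :: nat and \<alpha> \<beta> la :: "nat list"
  assumes "1 \<le> n" and "is_partition n la"
  shows "multiplicity la n (component n \<alpha> \<beta>) (comp_rep n \<alpha> \<beta>)
         = card (multiset_tableaux la (target_content \<alpha> \<beta>))"
proof -
  obtain t0 where "t0 \<in> tableaux la n" using ex_tableau[OF assms(2)] by auto
  with assms(2) interpret tableau_module n \<alpha> \<beta> la t0 by unfold_locales
  show ?thesis using multiplicity_eq_card_SS bij_betw_same_card[OF bij_filling] by simp
qed

end
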